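(* The class $\mathcal{G}$ is closed under countable graph products. That is, let $\Gamma = (V,E)$ be a graph with $V$ a finite or countably infinite set and $E \subset \{\{u,v\} : u,v\in V,\ u \neq v\}$, and let $(G_i)_{i \in V}$ be a family of groups with $G_i \in \mathcal{G}$ for every $i \in V$. Then the graph product $\overline{G}^\Gamma$ of the family $\overline{G} = (G_i)_{i\in V}$ along $\Gamma$ belongs to $\mathcal{G}$.
   Context: For a finite alphabet $\Sigma$ with $|\Sigma|\ge 2$, $\mathrm{Aut}(\Sigma^{\mathbb{Z}})$ is the group of homeomorphisms $f:\Sigma^{\mathbb{Z}}\to\Sigma^{\mathbb{Z}}$ (product topology) commuting with the shift $\sigma(x)_i = x_{i+1}$ (reversible cellular automata). $\mathcal{G}$ is the class of groups isomorphic to a subgroup of $\mathrm{Aut}(\Sigma^{\mathbb{Z}})$; by a known theorem of Kim and Roush this class does not depend on the choice of the finite alphabet $\Sigma$ with $|\Sigma|\geq 2$. The graph product is the group $\overline{G}^\Gamma = \langle \bigcup_{i\in V} G_i \mid [a,b]=e \text{ for all } \{i,j\}\in E,\ a\in G_i,\ b\in G_j\rangle$, where the groups $G_i$ are taken disjoint apart from sharing the identity and the relations of each $G_i$ are also imposed (i.e. the quotient of the free product of the $G_i$ by the normal closure of these commutators). *)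

theory Defs
  imports "HOL-Analysis.Analysis" "HOL-Algebra.Coset" "HOL-Library.Countable_Set"
begin

section \<open>Automorphism groups of full shifts\<close>

text \<open>The alphabet is a finite type \<open>'a\<close>; it carries the discrete topology, and configurations
  \<open>int \<Rightarrow> 'a\<close> carry the product topology.\<close>

definition full_shift :: "(int \<Rightarrow> 'a::finite) topology" where
  "full_shift = product_topology (\<lambda>_. discrete_topology UNIV) UNIV"

definition shift :: "(int \<Rightarrow> 'a) \<Rightarrow> (int \<Rightarrow> 'a)" where
  "shift x = (\<lambda>i. x (i + 1))"

definition Aut_full_shift :: "((int \<Rightarrow> 'a::finite) \<Rightarrow> (int \<Rightarrow> 'a)) monoid" where
  "Aut_full_shift =
     \<lparr>carrier = {f. homeomorphic_map full_shift full_shift f \<and> f \<circ> shift = shift \<circ> f},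
      mult = (\<circ>), one = id\<rparr>"

lemma topspace_full_shift [simp]: "topspace full_shift = UNIV"
  by (simp add: full_shift_def)

lemma group_Aut_full_shift: "group (Aut_full_shift :: ((int \<Rightarrow> 'a::finite) \<Rightarrow> _) monoid)"
proof (rule groupI)
  fix f g :: "(int \<Rightarrow> 'a) \<Rightarrow> (int \<Rightarrow> 'a)"
  assume "f \<in> carrier Aut_full_shift" "g \<in> carrier Aut_full_shift"
  then have h: "homeomorphic_map full_shift full_shift f" "homeomorphic_map full_shift full_shift g"
    and c: "f \<circ> shift = shift \<circ> f" "g \<circ> shift = shift \<circ> g"
    by (auto simp: Aut_full_shift_def)
  have "f \<circ> g \<circ> shift = f \<circ> shift \<circ> g"
    by (simp only: comp_assoc c(2))
  also have "\<dots> = shift \<circ> (f \<circ> g)"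
    by (simp only: c(1) comp_assoc)
  finally show "f \<otimes>\<^bsub>Aut_full_shift\<^esub> g \<in> carrier Aut_full_shift"
    using homeomorphic_map_compose [OF h(2,1)] by (simp add: Aut_full_shift_def)
next
  fix f :: "(int \<Rightarrow> 'a) \<Rightarrow> (int \<Rightarrow> 'a)"
  assume "f \<in> carrier Aut_full_shift"
  then have f: "homeomorphic_map full_shift full_shift f" and c: "f \<circ> shift = shift \<circ> f"
    by (auto simp: Aut_full_shift_def)
  from f obtain g where g: "homeomorphic_maps full_shift full_shift f g"
    by (auto simp: homeomorphic_map_maps)
  then have gf: "g \<circ> f = id" and fg: "f \<circ> g = id"
    by (auto simp: homeomorphic_maps_def)
  have "g \<circ> shift = g \<circ> shift \<circ> (f \<circ> g)" by (simp add: fg)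
  also have "\<dots> = g \<circ> (shift \<circ> f) \<circ> g" by (simp add: comp_assoc)
  also have "\<dots> = (g \<circ> f) \<circ> shift \<circ> g" by (simp add: c [symmetric] comp_assoc)
  finally have "g \<circ> shift = shift \<circ> g" by (simp add: gf)
  moreover have "homeomorphic_map full_shift full_shift g"
    using g homeomorphic_map_maps homeomorphic_maps_sym by blast
  ultimately show "\<exists>g\<in>carrier Aut_full_shift. g \<otimes>\<^bsub>Aut_full_shift\<^esub> f = \<one>\<^bsub>Aut_full_shift\<^esub>"
    using gf by (auto simp: Aut_full_shift_def)
qed (auto simp: Aut_full_shift_def comp_assoc)

text \<open>The class of groups isomorphic to a subgroup of the automorphism group of the full shift over
  \<open>'a\<close>. The conjunct \<open>group G\<close> is needed because \<open>\<cong>\<close> only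
  concerns the carrier and the multiplication, not the \<open>one\<close> field of the record.\<close>

definition rca_group :: "'a::finite itself \<Rightarrow> ('g, 'm) monoid_scheme \<Rightarrow> bool" where
  "rca_group (_ :: 'a itself) G \<longleftrightarrow>
     group G \<and>
     (\<exists>H. subgroup H (Aut_full_shift :: ((int \<Rightarrow> 'a) \<Rightarrow> (int \<Rightarrow> 'a)) monoid) \<and>
          G \<cong> (Aut_full_shift :: ((int \<Rightarrow> 'a) \<Rightarrow> (int \<Rightarrow> 'a)) monoid)\<lparr>carrier := H\<rparr>)"

section \<open>Free products\<close>

text \<open>Letters are pairs \<open>(i, g)\<close> with \<open>g \<in> G i\<close>; tagging by the index makes the groups disjoint,
  and the identities are merged by the relation \<open>(i, 1) = []\<close>. The free product consists of the
  words modulo the congruence generated by the multiplication tables of the factors. Formal inverses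
  are not needed, since \<open>(i, inv g)\<close> is inverse to \<open>(i, g)\<close>.\<close>

definition fp_words :: "'v set \<Rightarrow> ('v \<Rightarrow> ('g, 'm) monoid_scheme) \<Rightarrow> ('v \<times> 'g) list set" where
  "fp_words V G = lists (SIGMA i:V. carrier (G i))"

inductive_set fp_rel :: "'v set \<Rightarrow> ('v \<Rightarrow> ('g, 'm) monoid_scheme) \<Rightarrow>
    (('v \<times> 'g) list \<times> ('v \<times> 'g) list) set"
  for V :: "'v set" and G :: "'v \<Rightarrow> ('g, 'm) monoid_scheme" where
  fp_refl: "u \<in> fp_words V G \<Longrightarrow> (u, u) \<in> fp_rel V G"
| fp_sym: "(u, v) \<in> fp_rel V G \<Longrightarrow> (v, u) \<in> fp_rel V G"
| fp_trans: "(u, v) \<in> fp_rel V G \<Longrightarrow> (v, w) \<in> fp_rel V G \<Longrightarrow> (u, w) \<in> fp_rel V G"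
| fp_one: "u \<in> fp_words V G \<Longrightarrow> w \<in> fp_words V G \<Longrightarrow> i \<in> V \<Longrightarrow>
    (u @ [(i, \<one>\<^bsub>G i\<^esub>)] @ w, u @ w) \<in> fp_rel V G"
| fp_mult: "u \<in> fp_words V G \<Longrightarrow> w \<in> fp_words V G \<Longrightarrow> i \<in> V \<Longrightarrow>
    g \<in> carrier (G i) \<Longrightarrow> h \<in> carrier (G i) \<Longrightarrow>
    (u @ [(i, g), (i, h)] @ w, u @ [(i, g \<otimes>\<^bsub>G i\<^esub> h)] @ w) \<in> fp_rel V G"

definition free_product ::
    "'v set \<Rightarrow> ('v \<Rightarrow> ('g, 'm) monoid_scheme) \<Rightarrow> ('v \<times> 'g) list set monoid" where
  "free_product V G =
     \<lparr>carrier = fp_words V G // fp_rel V G,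
      mult = (\<lambda>A B. \<Union>u\<in>A. \<Union>w\<in>B. fp_rel V G `` {u @ w}),
      one = fp_rel V G `` {[]}\<rparr>"

definition fp_inj :: "'v set \<Rightarrow> ('v \<Rightarrow> ('g, 'm) monoid_scheme) \<Rightarrow> 'v \<Rightarrow> 'g \<Rightarrow> ('v \<times> 'g) list set" where
  "fp_inj V G i g = fp_rel V G `` {[(i, g)]}"

section \<open>Graph products\<close>

definition normal_closure :: "('g, 'm) monoid_scheme \<Rightarrow> 'g set \<Rightarrow> 'g set" where
  "normal_closure F S = \<Inter>{N. N \<lhd> F \<and> S \<subseteq> N}"

definition graph_commutators ::
    "'v set \<Rightarrow> 'v set set \<Rightarrow> ('v \<Rightarrow> ('g, 'm) monoid_scheme) \<Rightarrow> ('v \<times> 'g) list set set" where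
  "graph_commutators V E G =
     (let F = free_product V G in
      {x \<otimes>\<^bsub>F\<^esub> y \<otimes>\<^bsub>F\<^esub> inv\<^bsub>F\<^esub> x \<otimes>\<^bsub>F\<^esub> inv\<^bsub>F\<^esub> y | x y i j a b.
         i \<in> V \<and> j \<in> V \<and> {i, j} \<in> E \<and> a \<in> carrier (G i) \<and> b \<in> carrier (G j) \<and>
         x = fp_inj V G i a \<and> y = fp_inj V G j b})"

definition graph_product ::
    "'v set \<Rightarrow> 'v set set \<Rightarrow> ('v \<Rightarrow> ('g, 'm) monoid_scheme) \<Rightarrow> ('v \<times> 'g) list set set monoid" where
  "graph_product V E G =
     free_product V G Mod normal_closure (free_product V G) (graph_commutators V E G)"

section \<open>Well-definedness\<close>

lemma fp_words_append: "u @ w \<in> fp_words V G \<longleftrightarrow> u \<in> fp_words V G \<and> w \<in> fp_words V G"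
  by (auto simp: fp_words_def)

lemma fp_words_Nil: "[] \<in> fp_words V G"
  by (simp add: fp_words_def)

lemma fp_words_Cons:
  "(i, g) # w \<in> fp_words V G \<longleftrightarrow> i \<in> V \<and> g \<in> carrier (G i) \<and> w \<in> fp_words V G"
  by (auto simp: fp_words_def)

lemma fp_rel_words:
  assumes "\<And>i. i \<in> V \<Longrightarrow> group (G i)" and "(u, w) \<in> fp_rel V G"
  shows "u \<in> fp_words V G \<and> w \<in> fp_words V G"
  using assms(2)
proof (induction rule: fp_rel.induct)
  case (fp_one u w i)
  then interpret group "G i" using assms(1) by simp
  show ?case using fp_one by (simp add: fp_words_append fp_words_Cons)
next
  case (fp_mult u w i g h)
  then interpret group "G i" using assms(1) by simp
  show ?case using fp_mult by (simp add: fp_words_append fp_words_Cons fp_words_Nil)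
qed auto

lemma equiv_fp_rel:
  assumes "\<And>i. i \<in> V \<Longrightarrow> group (G i)"
  shows "equiv (fp_words V G) (fp_rel V G)"
proof (rule equivI)
  show "fp_rel V G \<subseteq> fp_words V G \<times> fp_words V G"
    using fp_rel_words [of V G, OF assms] by auto
  show "refl_on (fp_words V G) (fp_rel V G)"
    by (simp add: refl_on_def fp_refl)
  show "sym (fp_rel V G)" by (rule symI) (rule fp_sym)
  show "trans (fp_rel V G)" by (rule transI) (rule fp_trans)
qed

lemma fp_rel_context:
  assumes "(u, w) \<in> fp_rel V G" "x \<in> fp_words V G" "y \<in> fp_words V G"
  shows "(x @ u @ y, x @ w @ y) \<in> fp_rel V G"
  using assms(1)
proof (induction rule: fp_rel.induct)
  case (fp_refl u)
  then show ?case using assms by (simp add: fp_words_append fp_rel.fp_refl)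
next
  case (fp_sym u v)
  then show ?case by (simp add: fp_rel.fp_sym)
next
  case (fp_trans u v w)
  from fp_trans.IH show ?case by (rule fp_rel.fp_trans)
next
  case (fp_one u w i)
  then show ?case
    using fp_rel.fp_one [of "x @ u" V G "w @ y" i] assms by (simp add: fp_words_append)
next
  case (fp_mult u w i g h)
  then show ?case
    using fp_rel.fp_mult [of "x @ u" V G "w @ y" i g h] assms by (simp add: fp_words_append)
qed

lemma fp_rel_append:
  assumes "\<And>i. i \<in> V \<Longrightarrow> group (G i)" "(u, u') \<in> fp_rel V G" "(w, w') \<in> fp_rel V G"
  shows "(u @ w, u' @ w') \<in> fp_rel V G"
proof -
  have W: "w \<in> fp_words V G" "u' \<in> fp_words V G"
    using fp_rel_words [of V G, OF assms(1) assms(2)] fp_rel_words [of V G, OF assms(1) assms(3)]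
    by auto
  have "(u @ w, u' @ w) \<in> fp_rel V G"
    using fp_rel_context [OF assms(2) fp_words_Nil W(1)] by simp
  moreover have "(u' @ w, u' @ w') \<in> fp_rel V G"
    using fp_rel_context [OF assms(3) W(2) fp_words_Nil] by simp
  ultimately show ?thesis by (rule fp_trans)
qed

lemma free_product_mult_class:
  assumes "\<And>i. i \<in> V \<Longrightarrow> group (G i)" "u \<in> fp_words V G" "w \<in> fp_words V G"
  shows "fp_rel V G `` {u} \<otimes>\<^bsub>free_product V G\<^esub> fp_rel V G `` {w} = fp_rel V G `` {u @ w}"
proof -
  note eq = equiv_fp_rel [of V G, OF assms(1)]
  have *: "fp_rel V G `` {x @ y} = fp_rel V G `` {u @ w}"
    if "(u, x) \<in> fp_rel V G" "(w, y) \<in> fp_rel V G" for x y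
    using equiv_class_eq [OF eq fp_rel_append [of V G, OF assms(1) that]] by simp
  have "(u, u) \<in> fp_rel V G" "(w, w) \<in> fp_rel V G"
    using assms(2,3) by (auto intro: fp_refl)
  moreover have "(\<Union>x\<in>fp_rel V G `` {u}. \<Union>y\<in>fp_rel V G `` {w}. fp_rel V G `` {x @ y}) =
      (\<Union>x\<in>fp_rel V G `` {u}. \<Union>y\<in>fp_rel V G `` {w}. fp_rel V G `` {u @ w})"
    by (intro SUP_cong refl *) auto
  ultimately show ?thesis
    by (auto simp: free_product_def)
qed

lemma fp_words_inverse:
  assumes "\<And>i. i \<in> V \<Longrightarrow> group (G i)" "u \<in> fp_words V G"
  shows "\<exists>w\<in>fp_words V G. (w @ u, []) \<in> fp_rel V G"
  using assms(2)
proof (induction u)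
  case Nil
  show ?case by (rule bexI [of _ "[]"]) (auto intro: fp_refl fp_words_Nil)
next
  case (Cons p u)
  obtain i g where p: "p = (i, g)" by (cases p)
  have ig: "i \<in> V" "g \<in> carrier (G i)" and u: "u \<in> fp_words V G"
    using Cons.prems by (auto simp: p fp_words_Cons)
  interpret group "G i" using assms(1) ig by simp
  obtain w where w: "w \<in> fp_words V G" "(w @ u, []) \<in> fp_rel V G"
    using Cons.IH u by blast
  have "(w @ [(i, inv\<^bsub>G i\<^esub> g), (i, g)] @ u, w @ [(i, inv\<^bsub>G i\<^esub> g \<otimes>\<^bsub>G i\<^esub> g)] @ u) \<in> fp_rel V G"
    using w u ig by (intro fp_mult) auto
  then have "(w @ [(i, inv\<^bsub>G i\<^esub> g), (i, g)] @ u, w @ [(i, \<one>\<^bsub>G i\<^esub>)] @ u) \<in> fp_rel V G"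
    using ig by simp
  moreover have "(w @ [(i, \<one>\<^bsub>G i\<^esub>)] @ u, w @ u) \<in> fp_rel V G"
    using w u ig by (intro fp_one) auto
  ultimately have "(w @ [(i, inv\<^bsub>G i\<^esub> g), (i, g)] @ u, []) \<in> fp_rel V G"
    using w(2) fp_trans [OF _ fp_trans] by blast
  then have "((w @ [(i, inv\<^bsub>G i\<^esub> g)]) @ p # u, []) \<in> fp_rel V G"
    by (simp add: p)
  moreover have "w @ [(i, inv\<^bsub>G i\<^esub> g)] \<in> fp_words V G"
    using w ig by (simp add: fp_words_append fp_words_Cons fp_words_Nil)
  ultimately show ?case by blast
qed

lemma group_free_product:
  assumes "\<And>i. i \<in> V \<Longrightarrow> group (G i)"
  shows "group (free_product V G)"
proof -
  note mult = free_product_mult_class [of V G, OF assms]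
  have one: "\<one>\<^bsub>free_product V G\<^esub> = fp_rel V G `` {[]}"
    by (simp add: free_product_def)
  have carrier: "x \<in> carrier (free_product V G) \<longleftrightarrow>
      (\<exists>u\<in>fp_words V G. x = fp_rel V G `` {u})" for x
    by (auto simp: free_product_def quotient_def)
  show ?thesis
  proof (rule groupI)
    fix x y
    assume "x \<in> carrier (free_product V G)" "y \<in> carrier (free_product V G)"
    then show "x \<otimes>\<^bsub>free_product V G\<^esub> y \<in> carrier (free_product V G)"
      unfolding carrier by (metis mult fp_words_append)
  next
    show "\<one>\<^bsub>free_product V G\<^esub> \<in> carrier (free_product V G)"
      unfolding carrier one using fp_words_Nil by blast
  next
    fix x y z
    assume "x \<in> carrier (free_product V G)" "y \<in> carrier (free_product V G)"
      "z \<in> carrier (free_product V G)"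
    then show "x \<otimes>\<^bsub>free_product V G\<^esub> y \<otimes>\<^bsub>free_product V G\<^esub> z =
        x \<otimes>\<^bsub>free_product V G\<^esub> (y \<otimes>\<^bsub>free_product V G\<^esub> z)"
      unfolding carrier by (auto simp: mult fp_words_append)
  next
    fix x
    assume "x \<in> carrier (free_product V G)"
    then show "\<one>\<^bsub>free_product V G\<^esub> \<otimes>\<^bsub>free_product V G\<^esub> x = x"
      unfolding carrier one by (auto simp: mult fp_words_Nil)
  next
    fix x
    assume "x \<in> carrier (free_product V G)"
    then obtain u where u: "u \<in> fp_words V G" "x = fp_rel V G `` {u}"
      unfolding carrier by blast
    then obtain w where w: "w \<in> fp_words V G" "(w @ u, []) \<in> fp_rel V G"
      using fp_words_inverse [of V G, OF assms] by blast
    have "fp_rel V G `` {w} \<otimes>\<^bsub>free_product V G\<^esub> x = \<one>\<^bsub>free_product V G\<^esub>"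
      using u w equiv_class_eq [OF equiv_fp_rel [of V G, OF assms] w(2)] by (simp add: mult one)
    then show "\<exists>y\<in>carrier (free_product V G). y \<otimes>\<^bsub>free_product V G\<^esub> x = \<one>\<^bsub>free_product V G\<^esub>"
      using w(1) carrier by blast
  qed
qed

lemma fp_inj_hom:
  assumes "\<And>i. i \<in> V \<Longrightarrow> group (G i)" "i \<in> V"
  shows "fp_inj V G i \<in> hom (G i) (free_product V G)"
proof (rule homI)
  fix g assume "g \<in> carrier (G i)"
  then show "fp_inj V G i g \<in> carrier (free_product V G)"
    using assms(2)
    by (auto simp: fp_inj_def free_product_def fp_words_Cons fp_words_Nil intro!: quotientI)
next
  fix g h assume gh: "g \<in> carrier (G i)" "h \<in> carrier (G i)"
  have "([(i, g), (i, h)], [(i, g \<otimes>\<^bsub>G i\<^esub> h)]) \<in> fp_rel V G"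
    using fp_mult [of "[]" V G "[]" i g h] assms(2) gh by (simp add: fp_words_Nil)
  then have "fp_rel V G `` {[(i, g), (i, h)]} = fp_rel V G `` {[(i, g \<otimes>\<^bsub>G i\<^esub> h)]}"
    using equiv_class_eq [OF equiv_fp_rel [of V G, OF assms(1)]] by blast
  then show "fp_inj V G i (g \<otimes>\<^bsub>G i\<^esub> h) =
      fp_inj V G i g \<otimes>\<^bsub>free_product V G\<^esub> fp_inj V G i h"
    using gh assms by (simp add: fp_inj_def free_product_mult_class fp_words_Cons fp_words_Nil)
qed

lemma graph_commutators_subset:
  assumes "\<And>i. i \<in> V \<Longrightarrow> group (G i)"
  shows "graph_commutators V E G \<subseteq> carrier (free_product V G)"
proof -
  interpret F: group "free_product V G" by (rule group_free_product [of V G, OF assms])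
  have "fp_inj V G i a \<in> carrier (free_product V G)" if "i \<in> V" "a \<in> carrier (G i)" for i a
    using hom_in_carrier [OF fp_inj_hom [of V G i]] assms that by blast
  then show ?thesis
    by (auto simp: graph_commutators_def Let_def)
qed

lemma normal_normal_closure:
  assumes "group F" "S \<subseteq> carrier F"
  shows "normal_closure F S \<lhd> F"
proof -
  interpret group F by fact
  have "carrier F \<lhd> F"
    by (simp add: normal_inv_iff subgroup_self)
  then have ne: "{N. N \<lhd> F \<and> S \<subseteq> N} \<noteq> {}"
    using assms by blast
  have "subgroup (\<Inter>{N. N \<lhd> F \<and> S \<subseteq> N}) F"
    using ne by (intro subgroups_Inter) (auto dest: normal_imp_subgroup)
  then show ?thesis
    unfolding normal_closure_def by (auto simp: normal_inv_iff)
qed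

lemma group_graph_product:
  assumes "\<And>i. i \<in> V \<Longrightarrow> group (G i)"
  shows "group (graph_product V E G)"
  unfolding graph_product_def
  by (intro normal.factorgroup_is_group normal_normal_closure group_free_product
      graph_commutators_subset assms)

end

theory Submission
  imports Defs
begin

text \<open>
  Every vertex \<open>i\<close> owns certain words, called cells, which hold two symbols of payload. A maximal run of
  adjacent cells of \<open>i\<close> is folded to a cyclic conveyor belt on which \<open>G i\<close> acts by its cellular automata.
  Some cells of \<open>i\<close> are conditional: they belong to a belt only if the cell to their left has a
  prescribed payload symbol and is owned by a vertex that is neither \<open>i\<close> nor adjacent to \<open>i\<close>. Hence
  the action of \<open>G i\<close> never changes the belts of \<open>i\<close> or of its neighbours, and the actions of the \<open>G i\<close>
  extend to the graph product.

  Let \<open>w = g w'\<close> be a nonempty reduced word with \<open>g\<close> in \<open>G i\<close>. By induction there are two configurations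
  with a distinguished payload symbol of \<open>i\<close> on which all proper suffixes of \<open>w\<close> have the same effect, whereas
  \<open>w\<close> makes it different; so \<open>w\<close> acts nontrivially. If \<open>i\<close> occurs in \<open>w'\<close>, then \<open>w'\<close> contains a
  first letter of a nonadjacent vertex \<open>j\<close>, before which \<open>i\<close> does not occur; take the configurations
  for the suffix starting there and append a belt of \<open>i\<close> with one conditional cell that reads the
  distinguished symbol of \<open>j\<close>. Otherwise let the conditional cell read a symbol that nobody changes.
\<close>

section \<open>Continuity of maps on the full shift\<close>

text \<open>The obstacle is that \<open>V\<close> may be infinite while every automaton needs finite
  windows, so a vertex cannot recognize the owner of a left neighbour by its code. It recognizes a
  tag instead: \<open>i\<close> acts only on cells with tags in a finite set \<open>Out i\<close>
  and reads only finitely many tags. Noninterference means that the tags read by \<open>i\<close>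
  are disjoint from \<open>Out j\<close>; observability means that they share a tag. A second
  difficulty is that letters of \<open>i\<close> inside \<open>w'\<close> act on the new belt before
  \<open>g\<close> does. Each such action is invertible, so the contents are prescribed for the
  moment just before \<open>g\<close> and traced back. The trace depends on the state of the
  conditional cell at those letters; it is the same for both configurations because every letter of
  \<open>i\<close> acts at a time when they still show the same symbol. Finally, \<open>G i\<close>
  is known only through some embedding, so all that is available about \<open>g\<close> is that its
  automorphism is not the identity. Density of periodic configurations makes this visible on finite
  belts, as a difference between two lengths.\<close>

definition locdet :: "((int \<Rightarrow> 'a) \<Rightarrow> 'b) \<Rightarrow> bool" where
  "locdet h \<longleftrightarrow> (\<forall>x. \<exists>J. finite J \<and> (\<forall>y. (\<forall>j\<in>J. y j = x j) \<longrightarrow> h y = h x))"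

lemma locdetE:
  assumes "locdet h"
  obtains J where "finite J" "\<And>y. \<forall>j\<in>J. y j = x j \<Longrightarrow> h y = h x"
  using assms unfolding locdet_def by metis

lemma locdet_const: "locdet (\<lambda>x. c)"
  by (auto simp: locdet_def)

lemma locdet_eval: "locdet (\<lambda>x. x r)"
  unfolding locdet_def by (metis finite.emptyI finite.insertI insertI1)

text \<open>Once the window of \<open>h\<close> at \<open>x\<close> has fixed the value
  \<open>h x\<close>, the window of \<open>k (h x)\<close> can be chosen; the union of the two
  serves. Windows that depend on \<open>x\<close> make this sequential inspection possible.\<close>

lemma locdet_bind:
  assumes "locdet h" "\<And>v. locdet (k v)"
  shows "locdet (\<lambda>x. k (h x) x)"
  unfolding locdet_def
proof
  fix x
  obtain J where J: "finite J" "\<And>y. \<forall>j\<in>J. y j = x j \<Longrightarrow> h y = h x"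
    by (rule locdetE [OF assms(1), where x = x]) blast
  obtain K where K: "finite K" "\<And>y. \<forall>j\<in>K. y j = x j \<Longrightarrow> k (h x) y = k (h x) x"
    by (rule locdetE [OF assms(2), where x = x]) blast
  have "k (h y) y = k (h x) x" if "\<forall>j\<in>J \<union> K. y j = x j" for y
  proof -
    have "h y = h x" by (rule J(2)) (use that in blast)
    moreover have "k (h x) y = k (h x) x" by (rule K(2)) (use that in blast)
    ultimately show ?thesis by simp
  qed
  then show "\<exists>J. finite J \<and> (\<forall>y. (\<forall>j\<in>J. y j = x j) \<longrightarrow> k (h y) y = k (h x) x)"
    using J(1) K(1) by blast
qed

lemma locdet_conj:
  assumes "locdet P" "locdet Q" shows "locdet (\<lambda>x. P x \<and> Q x)"
  by (rule locdet_bind [OF assms(1)], rule locdet_bind [OF assms(2)], rule locdet_const)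

lemma locdet_if:
  assumes "locdet P" "locdet h" "locdet k" shows "locdet (\<lambda>x. if P x then h x else k x)"
proof (rule locdet_bind [OF assms(1), of "\<lambda>v x. if v then h x else k x"])
  show "locdet (\<lambda>x. if v then h x else k x)" for v using assms by (cases v) auto
qed

lemma locdet_eq: "locdet (\<lambda>x. x r = a)"
  by (rule locdet_bind [OF locdet_eval, of "\<lambda>v x. v = a"]) (rule locdet_const)

text \<open>At \<open>x\<close> the map \<open>h\<close> consults only finitely many entries of
  \<open>s x\<close>, and each of them has a finite window. This serves to apply an automorphism to
  the contents read along an orbit.\<close>

lemma locdet_seq:
  assumes "locdet h" "\<And>k. locdet (\<lambda>x. s x k)"
  shows "locdet (\<lambda>x. h (s x))"
  unfolding locdet_def
proof
  fix x
  obtain K where K: "finite K" "\<And>y. \<forall>j\<in>K. y j = s x j \<Longrightarrow> h y = h (s x)"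
    by (rule locdetE [OF assms(1), where x = "s x"]) blast
  have "\<forall>k. \<exists>J. finite J \<and> (\<forall>y. (\<forall>j\<in>J. y j = x j) \<longrightarrow> s y k = s x k)"
    using assms(2) unfolding locdet_def by blast
  then obtain J where J: "\<And>k. finite (J k)" "\<And>k y. (\<forall>j\<in>J k. y j = x j) \<Longrightarrow> s y k = s x k"
    by metis
  have "h (s y) = h (s x)" if "\<forall>j\<in>\<Union>(J ` K). y j = x j" for y
    by (rule K(2), intro ballI J(2)) (use that in blast)
  moreover have "finite (\<Union>(J ` K))" using K(1) J(1) by auto
  ultimately show "\<exists>J. finite J \<and> (\<forall>y. (\<forall>j\<in>J. y j = x j) \<longrightarrow> h (s y) = h (s x))"
    by blast
qed

lemma locdet_Collect:
  assumes "finite D" "\<And>d. d \<in> D \<Longrightarrow> locdet (\<lambda>x. P x d)"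
  shows "locdet (\<lambda>x. {d \<in> D. P x d})"
  unfolding locdet_def
proof
  fix x
  have "\<forall>d\<in>D. \<exists>J. finite J \<and> (\<forall>y. (\<forall>j\<in>J. y j = x j) \<longrightarrow> P y d = P x d)"
    using assms(2) unfolding locdet_def by blast
  then obtain J where J: "\<And>d. d \<in> D \<Longrightarrow> finite (J d)"
      "\<And>d y. d \<in> D \<Longrightarrow> (\<forall>j\<in>J d. y j = x j) \<Longrightarrow> P y d = P x d"
    by metis
  have "{d \<in> D. P y d} = {d \<in> D. P x d}" if "\<forall>j\<in>\<Union>(J ` D). y j = x j" for y
  proof -
    have "P y d = P x d" if "d \<in> D" for d
      by (rule J(2) [OF that]) (use that \<open>\<forall>j\<in>\<Union>(J ` D). y j = x j\<close> in blast)
    then show ?thesis by blast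
  qed
  moreover have "finite (\<Union>(J ` D))" using assms(1) J(1) by auto
  ultimately show "\<exists>J. finite J \<and> (\<forall>y. (\<forall>j\<in>J. y j = x j) \<longrightarrow> {d \<in> D. P y d} = {d \<in> D. P x d})"
    by blast
qed

lemma locdet_Bex:
  assumes "finite D" "\<And>d. d \<in> D \<Longrightarrow> locdet (\<lambda>x. P x d)"
  shows "locdet (\<lambda>x. \<exists>d\<in>D. P x d)"
proof -
  have "locdet (\<lambda>x. {d \<in> D. P x d} \<noteq> {})"
    by (rule locdet_bind [OF locdet_Collect [OF assms], where k = "\<lambda>S x. S \<noteq> {}"])
       (simp_all add: locdet_const)
  then show ?thesis by (rule back_subst [of locdet]) auto
qed

lemma locdet_Ball:
  assumes "finite D" "\<And>d. d \<in> D \<Longrightarrow> locdet (\<lambda>x. P x d)"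
  shows "locdet (\<lambda>x. \<forall>d\<in>D. P x d)"
proof -
  have "locdet (\<lambda>x. {d \<in> D. P x d} = D)"
    by (rule locdet_bind [OF locdet_Collect [OF assms], where k = "\<lambda>S x. S = D"])
       (simp_all add: locdet_const)
  then show ?thesis by (rule back_subst [of locdet]) auto
qed

lemma continuous_locdet:
  "continuous_map full_shift (discrete_topology UNIV) h \<longleftrightarrow> locdet h"
proof
  assume c: "continuous_map full_shift (discrete_topology UNIV) h"
  show "locdet h" unfolding locdet_def
  proof
    fix x
    have "openin full_shift {y \<in> topspace full_shift. h y \<in> {h x}}"
      using c by (rule openin_continuous_map_preimage) auto
    then have o: "openin full_shift {y. h y = h x}" by simp
    moreover have "x \<in> {y. h y = h x}" by simp
    ultimately have "\<exists>U. finite {i \<in> UNIV. U i \<noteq> topspace (discrete_topology UNIV)} \<and>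
        (\<forall>i\<in>UNIV. openin (discrete_topology UNIV) (U i)) \<and> x \<in> Pi\<^sub>E UNIV U \<and> Pi\<^sub>E UNIV U \<subseteq> {y. h y = h x}"
      unfolding full_shift_def openin_product_topology_alt by blast
    then obtain U where U: "finite {i. U i \<noteq> UNIV}" "x \<in> Pi\<^sub>E UNIV U" "Pi\<^sub>E UNIV U \<subseteq> {y. h y = h x}"
      by auto
    have "h y = h x" if "\<forall>j\<in>{i. U i \<noteq> UNIV}. y j = x j" for y
    proof -
      have "y j \<in> U j" for j
        using that U(2) by (cases "U j = UNIV") (auto simp: PiE_iff)
      then show ?thesis using U(3) by (auto simp: PiE_iff subset_iff)
    qed
    then show "\<exists>J. finite J \<and> (\<forall>y. (\<forall>j\<in>J. y j = x j) \<longrightarrow> h y = h x)"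
      using U(1) by blast
  qed
next
  assume l: "locdet h"
  have "openin full_shift {y. h y \<in> S}" for S
    unfolding full_shift_def openin_product_topology_alt
  proof (rule ballI)
    fix x assume x: "x \<in> {y. h y \<in> S}"
    obtain J where J: "finite J" "\<And>y. \<forall>j\<in>J. y j = x j \<Longrightarrow> h y = h x"
      by (rule locdetE [OF l, where x = x]) blast
    let ?U = "\<lambda>j. if j \<in> J then {x j} else UNIV"
    have "{i \<in> UNIV. ?U i \<noteq> topspace (discrete_topology UNIV)} \<subseteq> J" by auto
    then have "finite {i \<in> UNIV. ?U i \<noteq> topspace (discrete_topology UNIV)}"
      using J(1) finite_subset by blast
    moreover have "x \<in> Pi\<^sub>E UNIV ?U" by (simp add: PiE_iff)
    moreover have "Pi\<^sub>E UNIV ?U \<subseteq> {y. h y \<in> S}"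
    proof
      fix y assume y: "y \<in> Pi\<^sub>E UNIV ?U"
      have "y j = x j" if "j \<in> J" for j
        using PiE_mem [OF y, of j] that by simp
      then show "y \<in> {y. h y \<in> S}" using J(2) [of y] x by simp
    qed
    ultimately show "\<exists>U. finite {i \<in> UNIV. U i \<noteq> topspace (discrete_topology UNIV)} \<and>
        (\<forall>i\<in>UNIV. openin (discrete_topology UNIV) (U i)) \<and> x \<in> Pi\<^sub>E UNIV U \<and> Pi\<^sub>E UNIV U \<subseteq> {y. h y \<in> S}"
      by (intro exI [of _ ?U]) simp
  qed
  then show "continuous_map full_shift (discrete_topology UNIV) h"
    by (auto simp: continuous_map_def)
qed

lemma continuous_full_shift:
  "continuous_map full_shift full_shift f \<longleftrightarrow> (\<forall>r. locdet (\<lambda>x. f x r))"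
  unfolding continuous_locdet [symmetric]
  by (subst (2) full_shift_def) (simp add: continuous_map_componentwise_UNIV)

lemma Aut_full_shiftI:
  assumes "\<And>r. locdet (\<lambda>x. f x r)" "\<And>r. locdet (\<lambda>x. g x r)"
    and "f \<circ> g = id" "g \<circ> f = id" "f \<circ> shift = shift \<circ> f"
  shows "f \<in> carrier Aut_full_shift"
proof -
  have "homeomorphic_maps full_shift full_shift f g"
    using assms by (auto simp: homeomorphic_maps_def continuous_full_shift fun_eq_iff)
  then show ?thesis
    using assms(5) by (auto simp: Aut_full_shift_def homeomorphic_map_maps)
qed

lemma Aut_locdet:
  assumes "f \<in> carrier Aut_full_shift"
  shows "locdet (\<lambda>x. f x r)"
  using assms by (auto simp: Aut_full_shift_def continuous_full_shift dest: homeomorphic_imp_continuous_map)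

lemma Aut_shift:
  assumes "f \<in> carrier Aut_full_shift"
  shows "f (\<lambda>i. x (i + k)) r = f x (r + k)"
proof -
  have c: "f (\<lambda>i. y (i + 1)) j = f y (j + 1)" for y j
    using assms by (auto simp: Aut_full_shift_def fun_eq_iff shift_def)
  have "\<forall>r. f (\<lambda>i. x (i + k)) r = f x (r + k)"
  proof (induction k rule: int_induct [where k = 0])
    case (step1 k)
    have "(\<lambda>i. x (i + (k + 1))) = (\<lambda>i. x (i + 1 + k))"
      by (simp add: algebra_simps)
    then have "f (\<lambda>i. x (i + (k + 1))) r = f x (r + 1 + k)" for r
      using step1 c [of "\<lambda>i. x (i + k)" r] by simp
    then show ?case by (simp add: algebra_simps)
  next
    case (step2 k)
    have "(\<lambda>i. x (i + k)) = (\<lambda>i. x (i + 1 + (k - 1)))"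
      by (simp add: algebra_simps)
    then have "f (\<lambda>i. x (i + k)) (r - 1) = f (\<lambda>i. x (i + (k - 1))) (r - 1 + 1)" for r
      using c [of "\<lambda>i. x (i + (k - 1))" "r - 1"] by simp
    then have "f (\<lambda>i. x (i + (k - 1))) r = f x (r - 1 + k)" for r
      using step2 by simp
    then show ?case by (simp add: algebra_simps)
  qed simp
  then show ?thesis by simp
qed

lemma Aut_simps:
  "f \<otimes>\<^bsub>Aut_full_shift\<^esub> g = f \<circ> g" "\<one>\<^bsub>Aut_full_shift\<^esub> = id"
  by (simp_all add: Aut_full_shift_def)

section \<open>Conveyor belts\<close>

text \<open>A partial injection \<open>R\<close> splits its field into chains. Every point \<open>p\<close> gets two slots, \<open>(p, True)\<close> and
  \<open>(p, False)\<close>; \<open>turn R\<close> runs forwards through the upper slots of a chain, backwards through the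
  lower ones, and turns around at the ends, so a finite chain becomes a cycle and an infinite one a
  copy of the integers. An automorphism of the full shift acts on the contents along each of these
  orbits.\<close>

definition partial_inj :: "('a \<times> 'a) set \<Rightarrow> bool" where
  "partial_inj R \<longleftrightarrow> single_valued R \<and> single_valued (R\<inverse>)"

definition turn :: "('s \<times> 's) set \<Rightarrow> 's \<times> bool \<Rightarrow> 's \<times> bool" where
  "turn R \<sigma> = (let S = (if snd \<sigma> then R `` {fst \<sigma>} else R\<inverse> `` {fst \<sigma>})
     in if S = {} then (fst \<sigma>, \<not> snd \<sigma>) else (the_elem S, snd \<sigma>))"

definition flip :: "'s \<times> bool \<Rightarrow> 's \<times> bool" where
  "flip \<sigma> = (fst \<sigma>, \<not> snd \<sigma>)"

text \<open>Exchanging the upper and the lower slots reverses the direction of travel, so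
  conjugation with \<open>flip\<close> gives the inverse of \<open>turn\<close>.\<close>

definition unturn :: "('s \<times> 's) set \<Rightarrow> 's \<times> bool \<Rightarrow> 's \<times> bool" where
  "unturn R \<sigma> = flip (turn R (flip \<sigma>))"

definition orb :: "('s \<times> 's) set \<Rightarrow> int \<Rightarrow> 's \<times> bool \<Rightarrow> 's \<times> bool" where
  "orb R k \<sigma> = (if 0 \<le> k then (turn R ^^ nat k) \<sigma> else (unturn R ^^ nat (- k)) \<sigma>)"

text \<open>\<open>A\<close> is a separate argument because a point without neighbours lies outside
  the field of \<open>R\<close> and still forms a cycle of length two. The index \<open>0\<close>
  refers to the slot itself, as the start of its own orbit.\<close>

definition upd :: "('s \<times> 's) set \<Rightarrow> 's set \<Rightarrow> ((int \<Rightarrow> 'a) \<Rightarrow> int \<Rightarrow> 'a) \<Rightarrow> ('s \<times> bool \<Rightarrow> 'a)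
    \<Rightarrow> 's \<times> bool \<Rightarrow> 'a" where
  "upd R A f c \<sigma> = (if fst \<sigma> \<in> A then f (\<lambda>k. c (orb R k \<sigma>)) 0 else c \<sigma>)"

lemma flip_flip [simp]: "flip (flip \<sigma>) = \<sigma>"
  by (simp add: flip_def)

lemma turn_cases:
  assumes "partial_inj R"
  shows "(p, q) \<in> R \<Longrightarrow> turn R (p, True) = (q, True)"
    and "(p, q) \<in> R \<Longrightarrow> turn R (q, False) = (p, False)"
    and "p \<notin> Domain R \<Longrightarrow> turn R (p, True) = (p, False)"
    and "p \<notin> Range R \<Longrightarrow> turn R (p, False) = (p, True)"
proof -
  have "R `` {p} = {q}" if "(p, q) \<in> R" for p q
    using assms that by (auto simp: partial_inj_def dest: single_valuedD)
  then show "(p, q) \<in> R \<Longrightarrow> turn R (p, True) = (q, True)"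
    by (simp add: turn_def Let_def)
  have "R\<inverse> `` {q} = {p}" if "(p, q) \<in> R" for p q
    using assms that by (auto simp: partial_inj_def dest: single_valuedD)
  then show "(p, q) \<in> R \<Longrightarrow> turn R (q, False) = (p, False)"
    by (simp add: turn_def Let_def)
  show "p \<notin> Domain R \<Longrightarrow> turn R (p, True) = (p, False)"
    by (auto simp: turn_def Let_def)
  show "p \<notin> Range R \<Longrightarrow> turn R (p, False) = (p, True)"
    by (auto simp: turn_def Let_def)
qed

lemma unturn_turn:
  assumes "partial_inj R"
  shows "unturn R (turn R \<sigma>) = \<sigma>"
proof -
  obtain p b where \<sigma>: "\<sigma> = (p, b)" by (cases \<sigma>)
  note t = turn_cases [OF assms]
  show ?thesis
  proof (cases b)
    case True
    show ?thesis
    proof (cases "p \<in> Domain R")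
      case True
      then obtain q where "(p, q) \<in> R" by blast
      then show ?thesis using \<open>b\<close> by (simp add: \<sigma> unturn_def flip_def t)
    next
      case False
      then show ?thesis using \<open>b\<close> by (simp add: \<sigma> unturn_def flip_def t)
    qed
  next
    case False
    show ?thesis
    proof (cases "p \<in> Range R")
      case True
      then obtain q where "(q, p) \<in> R" by blast
      then show ?thesis using \<open>\<not> b\<close> by (simp add: \<sigma> unturn_def flip_def t)
    next
      case False
      then show ?thesis using \<open>\<not> b\<close> by (simp add: \<sigma> unturn_def flip_def t)
    qed
  qed
qed

lemma turn_unturn:
  assumes "partial_inj R"
  shows "turn R (unturn R \<sigma>) = \<sigma>"
proof -
  have "flip (turn R (unturn R \<sigma>)) = flip \<sigma>"
    using unturn_turn [OF assms, of "flip \<sigma>"] by (simp add: unturn_def)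
  then show ?thesis by (metis flip_flip)
qed

lemma orb_0 [simp]: "orb R 0 \<sigma> = \<sigma>"
  by (simp add: orb_def)

lemma orb_succ:
  assumes "partial_inj R"
  shows "orb R (k + 1) \<sigma> = turn R (orb R k \<sigma>)"
proof (cases "0 \<le> k")
  case True
  then have "nat (k + 1) = Suc (nat k)" by simp
  then show ?thesis using True by (simp add: orb_def)
next
  case False
  then have "nat (- k) = Suc (nat (- (k + 1)))" by simp
  then have "orb R k \<sigma> = unturn R ((unturn R ^^ nat (- (k + 1))) \<sigma>)"
    using False by (simp add: orb_def)
  moreover have "orb R (k + 1) \<sigma> = (unturn R ^^ nat (- (k + 1))) \<sigma>"
    using False by (cases "k = - 1") (auto simp: orb_def)
  ultimately show ?thesis by (simp add: turn_unturn [OF assms])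
qed

text \<open>The recursion determines \<open>z\<close> forwards, and backwards as well because
  \<open>turn R\<close> is injective.\<close>

lemma orb_unique:
  assumes "partial_inj R" "z 0 = \<sigma>" "\<And>k. z (k + 1) = turn R (z k)"
  shows "orb R k \<sigma> = z k"
proof (induction k rule: int_induct [where k = 0])
  case base
  then show ?case using assms(2) by simp
next
  case (step1 k)
  then show ?case by (simp add: orb_succ [OF assms(1)] assms(3))
next
  case (step2 k)
  have "turn R (orb R (k - 1) \<sigma>) = turn R (z (k - 1))"
    using orb_succ [OF assms(1), of "k - 1" \<sigma>] assms(3) [of "k - 1"] step2 by simp
  then show ?case by (metis unturn_turn [OF assms(1)])
qed

lemma orb_orb:
  assumes "partial_inj R"
  shows "orb R k (orb R l \<sigma>) = orb R (k + l) \<sigma>"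
  by (rule orb_unique [OF assms, where z = "\<lambda>k. orb R (k + l) \<sigma>"])
     (simp_all add: orb_succ [OF assms, symmetric] algebra_simps)

lemma fst_turn_closed:
  assumes "partial_inj R" "\<And>p q. (p, q) \<in> R \<Longrightarrow> p \<in> S \<longleftrightarrow> q \<in> S"
  shows "fst (turn R \<sigma>) \<in> S \<longleftrightarrow> fst \<sigma> \<in> S"
proof -
  obtain p b where \<sigma>: "\<sigma> = (p, b)" by (cases \<sigma>)
  note t = turn_cases [OF assms(1)]
  show ?thesis
  proof (cases b)
    case True
    then show ?thesis
      using t(1) [of p] t(3) [of p] assms(2) [of p] \<sigma> by (cases "p \<in> Domain R") auto
  next
    case False
    then show ?thesis
      using t(2) [of _ p] t(4) [of p] assms(2) [of _ p] \<sigma> by (cases "p \<in> Range R") auto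
  qed
qed

lemma fst_orb_closed:
  assumes "partial_inj R" "\<And>p q. (p, q) \<in> R \<Longrightarrow> p \<in> S \<longleftrightarrow> q \<in> S"
  shows "fst (orb R k \<sigma>) \<in> S \<longleftrightarrow> fst \<sigma> \<in> S"
proof (induction k rule: int_induct [where k = 0])
  case (step1 k)
  then show ?case using fst_turn_closed [of R S] assms by (simp add: orb_succ)
next
  case (step2 k)
  then show ?case
    using fst_turn_closed [of R S "orb R (k - 1) \<sigma>"] orb_succ [OF assms(1), of "k - 1" \<sigma>] assms by simp
qed simp

text \<open>Starting an orbit at another of its slots shifts the sequence read along it. As
  \<open>g\<close> commutes with shifts, the updated contents along the orbit are the
  \<open>g\<close>-image of the old ones, and \<open>f\<close> is applied to this image.\<close>

lemma upd_upd:
  assumes "partial_inj R" "R \<subseteq> A \<times> A" "g \<in> carrier Aut_full_shift"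
  shows "upd R A f (upd R A g c) = upd R A (f \<circ> g) c"
proof
  fix \<sigma> :: "'a \<times> bool"
  have "upd R A g c (orb R k \<sigma>) = g (\<lambda>l. c (orb R l \<sigma>)) k" if "fst \<sigma> \<in> A" for k
  proof -
    have "fst (orb R k \<sigma>) \<in> A"
      using fst_orb_closed [OF assms(1), of A] assms(2) that by blast
    then have "upd R A g c (orb R k \<sigma>) = g (\<lambda>l. c (orb R (l + k) \<sigma>)) 0"
      by (simp add: upd_def orb_orb [OF assms(1)])
    then show ?thesis
      using Aut_shift [OF assms(3), of "\<lambda>l. c (orb R l \<sigma>)" k 0] by simp
  qed
  then show "upd R A f (upd R A g c) \<sigma> = upd R A (f \<circ> g) c \<sigma>"
    by (simp add: upd_def)
qed

lemma upd_id: "upd R A id c = c"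
  by (auto simp: upd_def fun_eq_iff)

lemma partial_inj_subset: "partial_inj R \<Longrightarrow> R' \<subseteq> R \<Longrightarrow> partial_inj R'"
  unfolding partial_inj_def single_valued_def by blast

lemma orb_restrict:
  assumes "partial_inj R" "\<And>p q. (p, q) \<in> R \<Longrightarrow> p \<in> S \<longleftrightarrow> q \<in> S" "fst \<sigma> \<in> S"
  shows "orb (R \<inter> S \<times> S) k \<sigma> = orb R k \<sigma>"
proof (rule orb_unique)
  show "partial_inj (R \<inter> S \<times> S)" using assms(1) by (rule partial_inj_subset) simp
  fix k
  have "fst (orb R k \<sigma>) \<in> S" using fst_orb_closed [OF assms(1), of S] assms(2,3) by blast
  then have "R `` {fst (orb R k \<sigma>)} = (R \<inter> S \<times> S) `` {fst (orb R k \<sigma>)}"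
     "R\<inverse> `` {fst (orb R k \<sigma>)} = (R \<inter> S \<times> S)\<inverse> `` {fst (orb R k \<sigma>)}"
    using assms(2) by auto
  then show "orb R (k + 1) \<sigma> = turn (R \<inter> S \<times> S) (orb R k \<sigma>)"
    by (simp add: orb_succ [OF assms(1)] turn_def)
qed simp

text \<open>A set \<open>S\<close> closed under links in both directions is a union of whole chains,
  and no orbit leaves it. This isolates a single chain among all belts of a configuration.\<close>

lemma upd_restrict:
  assumes "partial_inj R" "\<And>p q. (p, q) \<in> R \<Longrightarrow> p \<in> S \<longleftrightarrow> q \<in> S" "S \<subseteq> A" "fst \<sigma> \<in> S"
    and "\<And>\<tau>. fst \<tau> \<in> S \<Longrightarrow> c \<tau> = c' \<tau>"
  shows "upd R A f c \<sigma> = upd (R \<inter> S \<times> S) S f c' \<sigma>"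
proof -
  have "c (orb R k \<sigma>) = c' (orb R k \<sigma>)" for k
    using fst_orb_closed [OF assms(1), of S] assms(2,4,5) by blast
  then show ?thesis
    using assms(3,4) orb_restrict [OF assms(1,2,4)] by (auto simp: upd_def)
qed

lemma upd_cong:
  assumes "R \<subseteq> A \<times> A" "partial_inj R" "\<And>\<sigma>. fst \<sigma> \<in> A \<Longrightarrow> c \<sigma> = c' \<sigma>" "fst \<sigma> \<in> A"
  shows "upd R A f c \<sigma> = upd R A f c' \<sigma>"
proof -
  have "fst (orb R k \<sigma>) \<in> A" for k
    using fst_orb_closed [OF assms(2), of A k \<sigma>] assms(1,4) by blast
  then have "c (orb R k \<sigma>) = c' (orb R k \<sigma>)" for k by (rule assms(3))
  then show ?thesis using assms(4) by (simp add: upd_def)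
qed

lemma locdet_turn:
  assumes "\<And>p. locdet (\<lambda>x. R x `` {p})" "\<And>p. locdet (\<lambda>x. (R x)\<inverse> `` {p})"
  shows "locdet (\<lambda>x. turn (R x) \<sigma>)"
proof -
  let ?h = "\<lambda>S. if S = {} then (fst \<sigma>, \<not> snd \<sigma>) else (the_elem S, snd \<sigma>)"
  have "locdet (\<lambda>x. ?h (if snd \<sigma> then R x `` {fst \<sigma>} else (R x)\<inverse> `` {fst \<sigma>}))"
    by (rule locdet_bind [where k = "\<lambda>S x. ?h S", OF _ locdet_const]) (cases "snd \<sigma>"; simp add: assms)
  then show ?thesis by (simp add: turn_def Let_def)
qed

lemma locdet_orb:
  assumes "\<And>p. locdet (\<lambda>x. R x `` {p})" "\<And>p. locdet (\<lambda>x. (R x)\<inverse> `` {p})"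
  shows "locdet (\<lambda>x. orb (R x) k \<sigma>)"
proof -
  have t: "locdet (\<lambda>x. (turn (R x) ^^ n) \<sigma>)" for n
  proof (induction n)
    case (Suc n)
    show ?case
      using locdet_bind [OF Suc, where k = "\<lambda>\<sigma> x. turn (R x) \<sigma>", OF locdet_turn] assms by simp
  qed (simp add: locdet_const)
  have b': "locdet (\<lambda>x. unturn (R x) \<sigma>)" for \<sigma>
    unfolding unturn_def
    by (rule locdet_bind [OF locdet_turn, where k = "\<lambda>\<sigma> x. flip \<sigma>"]) (simp_all add: assms locdet_const)
  have b: "locdet (\<lambda>x. (unturn (R x) ^^ n) \<sigma>)" for n
  proof (induction n)
    case (Suc n)
    show ?case
      using locdet_bind [OF Suc, where k = "\<lambda>\<sigma> x. unturn (R x) \<sigma>", OF b'] by simp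
  qed (simp add: locdet_const)
  show ?thesis
    by (cases "0 \<le> k") (simp_all add: orb_def t b)
qed

section \<open>Cells\<close>

text \<open>With \<open>0 = a0\<close> and \<open>1 = a1\<close>, a cell is a word \<open>1 1 0^(n+1) 1 0 b 0 a 0 0 1 0^(s+1) 1 0\<close>. It is addressed by
  the position \<open>p\<close> of \<open>a\<close>; the two slots of \<open>p\<close> are \<open>a\<close> and \<open>b\<close>. The block \<open>1 1\<close> occurs only at the beginning of a
  cell, whatever \<open>a\<close> and \<open>b\<close> are, so cells never overlap. The code \<open>n\<close> names the owner of the cell
  and possibly a condition on the left neighbour; that neighbour is inspected only through its
  last payload symbol \<open>a\<close> and its tag \<open>s\<close>, since its code may be arbitrarily long.\<close>

locale cell_code =
  fixes a0 a1 :: "'a::finite" and cond :: "nat \<Rightarrow> (nat \<times> 'a) option"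
  assumes a0_a1: "a0 \<noteq> a1"
begin

definition head :: "(int \<Rightarrow> 'a) \<Rightarrow> int \<Rightarrow> nat \<Rightarrow> bool" where
  "head x p n \<longleftrightarrow> x (p - int n - 7) = a1 \<and> x (p - int n - 6) = a1 \<and>
     (\<forall>k\<in>{p - int n - 5..p - 5}. x k = a0) \<and> x (p - 4) = a1 \<and> x (p - 3) = a0 \<and> x (p - 1) = a0"

definition tail :: "(int \<Rightarrow> 'a) \<Rightarrow> int \<Rightarrow> nat \<Rightarrow> bool" where
  "tail x p s \<longleftrightarrow> x (p + 1) = a0 \<and> x (p + 2) = a0 \<and> x (p + 3) = a1 \<and>
     (\<forall>k\<in>{p + 4..p + int s + 4}. x k = a0) \<and> x (p + int s + 5) = a1 \<and> x (p + int s + 6) = a0"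

definition cell :: "(int \<Rightarrow> 'a) \<Rightarrow> int \<Rightarrow> nat \<Rightarrow> nat \<Rightarrow> bool" where
  "cell x p n s \<longleftrightarrow> head x p n \<and> tail x p s"

text \<open>A cell with code \<open>n\<close> starts at \<open>p - n - 7\<close>, and a tail with
  tag \<open>t\<close> ends \<open>t + 6\<close> places after its payload symbol. Hence
  \<open>p - n - t - 14\<close> is the payload position of a tail that ends directly before the
  cell.\<close>

definition enabled :: "(int \<Rightarrow> 'a) \<Rightarrow> int \<Rightarrow> nat \<Rightarrow> bool" where
  "enabled x p n \<longleftrightarrow> (case cond n of None \<Rightarrow> True
     | Some (t, a) \<Rightarrow> tail x (p - int n - int t - 14) t \<and> x (p - int n - int t - 14) = a)"

text \<open>Restricting the tags to \<open>Out\<close> has two uses: the distance between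
  neighbouring cells stays bounded, and every changed payload symbol is followed by a tag from
  \<open>Out\<close>, so interference can be excluded by tags alone.\<close>

definition act :: "nat set \<Rightarrow> nat set \<Rightarrow> (int \<Rightarrow> 'a) \<Rightarrow> int set" where
  "act C Out x = {p. \<exists>n\<in>C. \<exists>s\<in>Out. cell x p n s \<and> enabled x p n}"

definition lnk :: "nat set \<Rightarrow> nat set \<Rightarrow> (int \<Rightarrow> 'a) \<Rightarrow> (int \<times> int) set" where
  "lnk C Out x = {(p, q). p \<in> act C Out x \<and> q \<in> act C Out x \<and>
     (\<exists>n\<in>C. \<exists>s\<in>Out. \<exists>m\<in>C. \<exists>t\<in>Out. cell x p n s \<and> cell x q m t \<and> q = p + int s + int m + 14)}"

definition cont :: "(int \<Rightarrow> 'a) \<Rightarrow> int \<times> bool \<Rightarrow> 'a" where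
  "cont x \<sigma> = x (if snd \<sigma> then fst \<sigma> else fst \<sigma> - 2)"

definition belt :: "nat set \<Rightarrow> nat set \<Rightarrow> ((int \<Rightarrow> 'a) \<Rightarrow> int \<Rightarrow> 'a) \<Rightarrow> (int \<Rightarrow> 'a) \<Rightarrow> int \<Rightarrow> 'a" where
  "belt C Out f x r =
     (if r \<in> act C Out x then upd (lnk C Out x) (act C Out x) f (cont x) (r, True)
      else if r + 2 \<in> act C Out x then upd (lnk C Out x) (act C Out x) f (cont x) (r + 2, False)
      else x r)"

definition reads :: "nat set \<Rightarrow> nat set" where
  "reads C = {t. \<exists>n\<in>C. \<exists>a. cond n = Some (t, a)}"

text \<open>The condition \<open>enabled\<close> is left out on purpose: it may itself depend on
  payloads, whereas cells survive changes of payloads. This makes the relation symmetric.\<close>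

definition modified :: "nat set \<Rightarrow> nat set \<Rightarrow> (int \<Rightarrow> 'a) \<Rightarrow> (int \<Rightarrow> 'a) \<Rightarrow> bool" where
  "modified C Out x y \<longleftrightarrow>
     (\<forall>r. y r \<noteq> x r \<longrightarrow> (\<exists>p. \<exists>n\<in>C. \<exists>s\<in>Out. cell x p n s \<and> (r = p \<or> r = p - 2)))"

section \<open>Parsing: cells are unambiguous and disjoint\<close>

lemma head_inside:
  assumes "head x p n" "x q = a1" "x (q + 1) = a1" "p - int n - 7 \<le> q" "q < p - 2"
  shows "q = p - int n - 7"
proof (rule ccontr)
  assume "q \<noteq> p - int n - 7"
  then consider "q = p - int n - 6" | "p - int n - 5 \<le> q" "q \<le> p - 5" | "q = p - 4" | "q = p - 3"
    using assms(4,5) by linarith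
  then have "x q = a0 \<or> x (q + 1) = a0"
  proof cases
    case 1
    then have "q + 1 \<in> {p - int n - 5..p - 5}" by simp
    then show ?thesis using assms(1) unfolding head_def by blast
  next
    case 3
    then have "q + 1 = p - 3" by simp
    moreover have "x (p - 3) = a0" using assms(1) by (simp add: head_def)
    ultimately have "x (q + 1) = a0" by (simp only:)
    then show ?thesis ..
  next
    case 4
    then show ?thesis using assms(1) by (simp add: head_def)
  next
    case 2
    then show ?thesis using assms(1) by (simp add: head_def)
  qed
  then show False using assms(2,3) a0_a1 by auto
qed

lemma tail_inside:
  assumes "tail x p s" "x q = a1" "x (q + 1) = a1" "p \<le> q" "q \<le> p + int s + 6"
  shows False
proof -
  consider "q = p" | "q = p + 1" | "q = p + 2" | "q = p + 3" | "p + 4 \<le> q" "q \<le> p + int s + 4"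
    | "q = p + int s + 5" | "q = p + int s + 6"
    using assms(4,5) by linarith
  then have "x q = a0 \<or> x (q + 1) = a0"
  proof cases
    case 4
    then have "q + 1 \<in> {p + 4..p + int s + 4}" by simp
    then show ?thesis using assms(1) unfolding tail_def by blast
  next
    case 6
    then have "q + 1 = p + int s + 6" by simp
    moreover have "x (p + int s + 6) = a0" using assms(1) by (simp add: tail_def)
    ultimately have "x (q + 1) = a0" by (simp only:)
    then show ?thesis ..
  qed (use assms(1) in \<open>simp_all add: tail_def\<close>)
  then show False using assms(2,3) a0_a1 by auto
qed

text \<open>The payload positions \<open>p - 2\<close> and \<open>p\<close> hold arbitrary symbols,
  but each lies between two fixed zeros, so payload cannot complete a block
  \<open>1 1\<close>.\<close>

lemma cell_inside:
  assumes "cell x p n s" "x q = a1" "x (q + 1) = a1" "p - int n - 7 \<le> q" "q \<le> p + int s + 6"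
  shows "q = p - int n - 7"
proof -
  have pm: "x (p - 1) = a0" using assms(1) by (simp add: cell_def head_def)
  consider "q < p - 2" | "q + 1 = p - 1" | "q = p - 1" | "p \<le> q" by linarith
  then show ?thesis
  proof cases
    case 1
    then show ?thesis using head_inside [OF _ assms(2-4)] assms(1) by (simp add: cell_def)
  next
    case 2
    then have "x (q + 1) = a0" using pm by (simp only:)
    then show ?thesis using assms(3) a0_a1 by simp
  next
    case 3
    then have "x q = a0" using pm by (simp only:)
    then show ?thesis using assms(2) a0_a1 by simp
  next
    case 4
    then show ?thesis using tail_inside [OF _ assms(2,3) 4 assms(5)] assms(1) by (simp add: cell_def)
  qed
qed

text \<open>The first \<open>1\<close> after the opening block ends the run of zeros, so a head with
  the shorter run would put a \<open>1\<close> inside the longer run.\<close>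

lemma head_unique:
  assumes "head x p n" "head x q m" "p - int n = q - int m"
  shows "n = m"
proof -
  have "\<not> n < m" if "head x p n" "head x q m" "p - int n = q - int m" for p q n m
  proof
    assume "n < m"
    then have "p - 4 \<in> {q - int m - 5..q - 5}" using that(3) by auto
    then have "x (p - 4) = a0" using that(2) by (simp add: head_def)
    then show False using that(1) a0_a1 by (simp add: head_def)
  qed
  from this [of p n q m] this [of q m p n] show ?thesis using assms by auto
qed

lemma tail_unique:
  assumes "tail x p s" "tail x p t"
  shows "s = t"
proof -
  have "\<not> s < t" if "tail x p s" "tail x p t" for s t
  proof
    assume "s < t"
    then have "p + int s + 5 \<in> {p + 4..p + int t + 4}" by auto
    then have "x (p + int s + 5) = a0" using that(2) by (simp add: tail_def)
    then show False using that(1) a0_a1 by (simp add: tail_def)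
  qed
  from this [of s t] this [of t s] show ?thesis using assms by auto
qed

text \<open>If a tail is expected directly to the left of a cell, then a genuine cell whose payload meets that
  place ends there and carries the expected tag.\<close>

lemma tail_tail:
  assumes "tail x r t" "tail x q u" "r \<le> q" "q + int u \<le> r + int t"
  shows "q = r \<and> u = t"
proof (rule ccontr)
  assume *: "\<not> ?thesis"
  have z: "x k = a0" if "r + 4 \<le> k" "k \<le> r + int t + 4" for k
    using assms(1) that by (auto simp: tail_def)
  have q3: "x (q + 3) = a1" and q1: "x (q + 1) = a0"
    using assms(2) by (auto simp: tail_def)
  consider "q = r" "u < t" | "q = r + 1" | "q = r + 2" | "q > r + 2"
    using * assms(3,4) by force
  then show False
  proof cases
    case 1
    then have "x (q + int u + 5) = a0" by (intro z) auto
    then show ?thesis using assms(2) a0_a1 by (simp add: tail_def)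
  next
    case 3
    then have "x (q + 1) = a1" using assms(1) by (simp add: tail_def algebra_simps)
    then show ?thesis using q1 a0_a1 by simp
  qed (use z [of "q + 3"] q3 a0_a1 assms(4) in auto)
qed

lemma cell_start:
  assumes "cell x p n s"
  shows "x (p - int n - 7) = a1" "x (p - int n - 7 + 1) = a1"
proof -
  have "p - int n - 7 + 1 = p - int n - 6" by simp
  then show "x (p - int n - 7) = a1" "x (p - int n - 7 + 1) = a1"
    using assms by (simp_all add: cell_def head_def)
qed

lemma cell_unique:
  assumes "cell x p n s" "cell x q m t" "p - int n = q - int m"
  shows "p = q \<and> n = m \<and> s = t"
proof -
  have "n = m" using head_unique [OF _ _ assms(3), of x] assms(1,2) by (simp add: cell_def)
  then have "p = q" using assms(3) by simp
  then show ?thesis using \<open>n = m\<close> tail_unique [of x p s t] assms(1,2) by (simp add: cell_def)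
qed

text \<open>If two cells overlap, then the opening block of the one that starts later lies inside
  the other, and \<open>cell_inside\<close> makes the two starts coincide.\<close>

lemma cell_disjoint:
  assumes "cell x p n s" "cell x q m t"
  shows "(p = q \<and> n = m \<and> s = t) \<or> p + int s + 6 < q - int m - 7 \<or> q + int t + 6 < p - int n - 7"
proof -
  have "p - int n = q - int m"
    if "\<not> p + int s + 6 < q - int m - 7" "\<not> q + int t + 6 < p - int n - 7"
  proof (cases "p - int n - 7 \<le> q - int m - 7")
    case True
    have "q - int m - 7 = p - int n - 7"
      by (rule cell_inside [OF assms(1) cell_start [OF assms(2)]]) (use True that in auto)
    then show ?thesis by simp
  next
    case False
    have "p - int n - 7 = q - int m - 7"
      by (rule cell_inside [OF assms(2) cell_start [OF assms(1)]]) (use False that in auto)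
    then show ?thesis by simp
  qed
  then show ?thesis using cell_unique [OF assms] by blast
qed

lemma cell_payload_unique:
  assumes "cell x p n s" "cell x q m t" "r = p \<or> r = p - 2" "r = q \<or> r = q - 2"
  shows "p = q"
  using cell_disjoint [OF assms(1,2)] assms(3,4) by auto

lemma cell_same:
  assumes "cell x p n s" "cell x p m t"
  shows "n = m \<and> s = t"
  using cell_disjoint [OF assms] by auto

lemma actE:
  assumes "p \<in> act C Out x"
  obtains n s where "n \<in> C" "s \<in> Out" "cell x p n s" "enabled x p n"
  using assms by (auto simp: act_def)

lemma lnk_subset: "lnk C Out x \<subseteq> act C Out x \<times> act C Out x"
  by (auto simp: lnk_def)

lemma lnkE:
  assumes "(p, q) \<in> lnk C Out x"
  obtains n s m t where "cell x p n s" "cell x q m t" "q = p + int s + int m + 14"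
  using assms by (auto simp: lnk_def)

text \<open>The tag of the left cell determines its end and thus the start of the right cell, which
  determines the right cell. Conversely, two cells that end directly before the same cell share
  their last position and therefore coincide.\<close>

lemma partial_inj_lnk: "partial_inj (lnk C Out x)"
  unfolding partial_inj_def
proof
  show "single_valued (lnk C Out x)"
  proof (rule single_valuedI)
    fix p q q' assume "(p, q) \<in> lnk C Out x" and *: "(p, q') \<in> lnk C Out x"
    then obtain n s m t where 1: "cell x p n s" "cell x q m t" "q = p + int s + int m + 14"
      by (elim lnkE)
    from * obtain n' s' m' t' where 2: "cell x p n' s'" "cell x q' m' t'" "q' = p + int s' + int m' + 14"
      by (elim lnkE)
    have "s = s'" using cell_same [OF 1(1) 2(1)] by simp
    then show "q = q'" using cell_unique [OF 1(2) 2(2)] 1(3) 2(3) by simp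
  qed
  show "single_valued ((lnk C Out x)\<inverse>)"
  proof (rule single_valuedI)
    fix p q q' assume "(p, q) \<in> (lnk C Out x)\<inverse>" "(p, q') \<in> (lnk C Out x)\<inverse>"
    then have *: "(q, p) \<in> lnk C Out x" "(q', p) \<in> lnk C Out x" by auto
    from *(1) obtain n s m t where 1: "cell x q n s" "cell x p m t" "p = q + int s + int m + 14"
      by (elim lnkE)
    from *(2) obtain n' s' m' t' where 2: "cell x q' n' s'" "cell x p m' t'" "p = q' + int s' + int m' + 14"
      by (elim lnkE)
    have "m = m'" using cell_same [OF 1(2) 2(2)] by simp
    then show "q = q'" using cell_disjoint [OF 1(1) 2(1)] 1(3) 2(3) by auto
  qed
qed

section \<open>Stability under changes of payloads\<close>

lemma cell_agree:
  assumes "cell x p n s" "\<And>r. p - int n - 7 \<le> r \<Longrightarrow> r \<le> p + int s + 6 \<Longrightarrow> r \<noteq> p \<Longrightarrow> r \<noteq> p - 2 \<Longrightarrow> y r = x r"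
  shows "cell y p n s"
  unfolding cell_def head_def tail_def
  by (intro conjI ballI; subst assms(2)) (use assms(1) in \<open>auto simp: cell_def head_def tail_def\<close>)

lemma tail_agree:
  assumes "tail x p s" "\<And>r. p < r \<Longrightarrow> r \<le> p + int s + 6 \<Longrightarrow> y r = x r"
  shows "tail y p s"
  unfolding tail_def
  by (intro conjI ballI; subst assms(2)) (use assms(1) in \<open>auto simp: tail_def\<close>)

lemma cell_modified_imp:
  assumes "modified C' O' x y" "cell x p n s"
  shows "cell y p n s"
proof (rule cell_agree [OF assms(2)], rule ccontr)
  fix r assume r: "p - int n - 7 \<le> r" "r \<le> p + int s + 6" "r \<noteq> p" "r \<noteq> p - 2" "y r \<noteq> x r"
  then obtain q m t where "cell x q m t" "r = q \<or> r = q - 2"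
    using assms(1) unfolding modified_def by blast
  then show False using cell_disjoint [OF assms(2), of q m t] r by auto
qed

lemma modified_sym:
  assumes "modified C' O' x y"
  shows "modified C' O' y x"
  unfolding modified_def
proof (intro allI impI)
  fix r assume "x r \<noteq> y r"
  then have "y r \<noteq> x r" by simp
  then obtain p n s where "n \<in> C'" "s \<in> O'" "cell x p n s" "r = p \<or> r = p - 2"
    using assms unfolding modified_def by blast
  then show "\<exists>p. \<exists>n\<in>C'. \<exists>s\<in>O'. cell y p n s \<and> (r = p \<or> r = p - 2)"
    using cell_modified_imp [OF assms] by blast
qed

lemma cell_modified:
  assumes "modified C' O' x y"
  shows "cell y p n s \<longleftrightarrow> cell x p n s"
  using cell_modified_imp assms modified_sym by blast

text \<open>Suppose that a change hits the window inspected by the condition. It belongs to a cell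
  that ends before the given cell, and \<open>tail_tail\<close> forces its tag to be the tag
  \<open>t\<close> of the condition. That tag is in \<open>reads C\<close>, whereas the changed cell
  has a tag in \<open>O'\<close>. The inspected tail need not belong to a cell, hence the whole
  window is considered.\<close>

lemma enabled_modified_imp:
  assumes "modified C' O' x y" "reads C \<inter> O' = {}" "cell x p n s" "n \<in> C" "enabled x p n"
  shows "enabled y p n"
proof (cases "cond n")
  case None
  then show ?thesis by (simp add: enabled_def)
next
  case (Some ta)
  obtain t a where ta: "ta = (t, a)" by (cases ta)
  define r where "r = p - int n - int t - 14"
  have e: "tail x r t" "x r = a"
    using assms(5) by (simp_all add: enabled_def Some ta r_def)
  have eq: "y k = x k" if k: "r \<le> k" "k \<le> r + int t + 6" for k
  proof (rule ccontr)
    assume "y k \<noteq> x k"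
    then obtain q m u where q: "m \<in> C'" "u \<in> O'" "cell x q m u" "k = q \<or> k = q - 2"
      using assms(1) unfolding modified_def by blast
    then have "q + int u + 6 < p - int n - 7"
      using cell_disjoint [OF assms(3), of q m u] k by (auto simp: r_def)
    then have "u = t"
      using tail_tail [OF e(1), of q u] q k by (auto simp: cell_def r_def)
    moreover have "t \<in> reads C" using Some assms(4) ta by (auto simp: reads_def)
    ultimately show False using q(2) assms(2) by blast
  qed
  then have "tail y r t" using tail_agree [OF e(1)] by simp
  moreover have "y r = a" using eq [of r] e(2) by simp
  ultimately show ?thesis by (simp add: enabled_def Some ta r_def)
qed

lemma act_modified:
  assumes "modified C' O' x y" "reads C \<inter> O' = {}"
  shows "act C Out y = act C Out x"
proof -
  have "act C Out x \<subseteq> act C Out y" if m: "modified C' O' x y" for x y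
  proof
    fix p assume "p \<in> act C Out x"
    then obtain n s where "n \<in> C" "s \<in> Out" "cell x p n s" "enabled x p n" by (rule actE)
    moreover from this have "cell y p n s" "enabled y p n"
      using cell_modified_imp [OF m] enabled_modified_imp [OF m assms(2)] by blast+
    ultimately show "p \<in> act C Out y" by (auto simp: act_def)
  qed
  then show ?thesis using assms(1) modified_sym [OF assms(1)] by blast
qed

lemma lnk_modified:
  assumes "modified C' O' x y" "reads C \<inter> O' = {}"
  shows "lnk C Out y = lnk C Out x"
  unfolding lnk_def cell_modified [OF assms(1)] act_modified [OF assms] ..

lemma modified_belt: "modified C Out x (belt C Out f x)"
  unfolding modified_def
proof (intro allI impI)
  fix r assume "belt C Out f x r \<noteq> x r"
  then have "r \<in> act C Out x \<or> r + 2 \<in> act C Out x"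
    by (auto simp: belt_def split: if_splits)
  then obtain p where "p \<in> act C Out x" "r = p \<or> r = p - 2" by force
  then show "\<exists>p. \<exists>n\<in>C. \<exists>s\<in>Out. cell x p n s \<and> (r = p \<or> r = p - 2)"
    unfolding act_def by blast
qed

text \<open>Slots of different cells never share a position, so the precedence between the two cases
  of \<open>belt\<close> does not matter.\<close>

lemma cont_belt:
  assumes "cell x p n s"
  shows "cont (belt C Out f x) (p, b) = upd (lnk C Out x) (act C Out x) f (cont x) (p, b)"
proof -
  have "q = p" if "q \<in> act C Out x" "p + 2 = q \<or> p - 2 = q" for q
  proof -
    obtain m t where "cell x q m t" using \<open>q \<in> act C Out x\<close> by (rule actE)
    then show ?thesis using cell_disjoint [OF assms, of q m t] that(2) by auto
  qed
  from this [of "p + 2"] this [of "p - 2"]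
  have "p + 2 \<notin> act C Out x" "p - 2 \<notin> act C Out x" by auto
  then show ?thesis by (cases b) (auto simp: cont_def belt_def upd_def)
qed

lemma belt_off:
  assumes "\<And>p. p \<in> act C Out x \<Longrightarrow> r \<noteq> p \<and> r \<noteq> p - 2"
  shows "belt C Out f x r = x r"
  using assms [of r] assms [of "r + 2"] by (auto simp: belt_def)

lemma belt_cong:
  assumes "act C Out y = act C Out x" "lnk C Out y = lnk C Out x"
    and "\<And>\<sigma>. fst \<sigma> \<in> act C Out x \<Longrightarrow> cont y \<sigma> = c \<sigma>"
  shows "belt C Out f y r =
     (if r \<in> act C Out x then upd (lnk C Out x) (act C Out x) f c (r, True)
      else if r + 2 \<in> act C Out x then upd (lnk C Out x) (act C Out x) f c (r + 2, False)
      else y r)"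
  unfolding belt_def assms(1,2)
  using upd_cong [OF lnk_subset partial_inj_lnk, of C Out x "cont y" c] assms(3) by simp

text \<open>A belt reads no tag that it may itself change, so active cells and links are the same
  before and after \<open>g\<close>. Both updates then run along the same orbits.\<close>

lemma belt_comp:
  assumes "reads C \<inter> Out = {}" "g \<in> carrier Aut_full_shift"
  shows "belt C Out f (belt C Out g x) = belt C Out (f \<circ> g) x"
proof
  fix r
  note m = modified_belt [of C Out x g]
  note a = act_modified [OF m assms(1), of Out] lnk_modified [OF m assms(1), of Out]
  have "cont (belt C Out g x) \<sigma> = upd (lnk C Out x) (act C Out x) g (cont x) \<sigma>"
    if "fst \<sigma> \<in> act C Out x" for \<sigma>
  proof -
    obtain n s where "cell x (fst \<sigma>) n s" using \<open>fst \<sigma> \<in> act C Out x\<close> by (rule actE)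
    then show ?thesis using cont_belt [of x "fst \<sigma>" n s C Out g "snd \<sigma>"] by simp
  qed
  note belt_cong [OF a this, of f r]
  also have "(if r \<in> act C Out x
        then upd (lnk C Out x) (act C Out x) f (upd (lnk C Out x) (act C Out x) g (cont x)) (r, True)
        else if r + 2 \<in> act C Out x
        then upd (lnk C Out x) (act C Out x) f (upd (lnk C Out x) (act C Out x) g (cont x)) (r + 2, False)
        else belt C Out g x r) = belt C Out (f \<circ> g) x r"
    unfolding upd_upd [OF partial_inj_lnk lnk_subset assms(2)] by (simp add: belt_def)
  finally show "belt C Out f (belt C Out g x) r = belt C Out (f \<circ> g) x r" .
qed

lemma belt_id: "belt C Out id x = x"
  by (auto simp: belt_def upd_id cont_def fun_eq_iff)

lemma cont_modified:
  assumes "modified C' O' x y" "C \<inter> C' = {}" "cell x p n s" "n \<in> C"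
  shows "cont y (p, b) = cont x (p, b)"
proof (rule ccontr)
  assume "cont y (p, b) \<noteq> cont x (p, b)"
  then obtain r where r: "y r \<noteq> x r" "r = p \<or> r = p - 2"
    by (auto simp: cont_def split: if_splits)
  then obtain q m t where "m \<in> C'" "cell x q m t" "r = q \<or> r = q - 2"
    using assms(1) unfolding modified_def by blast
  moreover from this have "p = q" using cell_payload_unique [OF assms(3)] r(2) by blast
  ultimately show False using assms(2-4) cell_same by blast
qed

lemma belt_commute:
  assumes "C \<inter> C' = {}" "reads C \<inter> O' = {}" "reads C' \<inter> Out = {}"
  shows "belt C Out f (belt C' O' g x) = belt C' O' g (belt C Out f x)"
proof
  fix r
  \<comment> \<open>At a payload position of an active cell of \<open>C\<close>, both orders reduce
    to \<open>belt C Out f x r\<close>. The variables are generalized so that the fact also applies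
    with the two belts exchanged.\<close>
  have sub: "belt C Out f (belt C' O' g x) r = belt C' O' g (belt C Out f x) r"
    if "C \<inter> C' = {}" "reads C \<inter> O' = {}" "reads C' \<inter> Out = {}" "r = p \<or> r = p - 2" "p \<in> act C Out x"
    for C C' Out O' f g p
  proof -
    note m = modified_belt [of C' O' x g]
    note a = act_modified [OF m that(2), of Out] lnk_modified [OF m that(2), of Out]
    have "cont (belt C' O' g x) \<sigma> = cont x \<sigma>" if "fst \<sigma> \<in> act C Out x" for \<sigma>
    proof -
      obtain n s where "n \<in> C" "cell x (fst \<sigma>) n s" using \<open>fst \<sigma> \<in> act C Out x\<close> by (rule actE)
      then show ?thesis
        using cont_modified [OF m \<open>C \<inter> C' = {}\<close>, of "fst \<sigma>" n s "snd \<sigma>"] by simp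
    qed
    note belt_cong [OF a this, of f r]
    also have "(if r \<in> act C Out x then upd (lnk C Out x) (act C Out x) f (cont x) (r, True)
        else if r + 2 \<in> act C Out x then upd (lnk C Out x) (act C Out x) f (cont x) (r + 2, False)
        else belt C' O' g x r) = belt C Out f x r"
      using that(4,5) by (auto simp: belt_def)
    finally have 1: "belt C Out f (belt C' O' g x) r = belt C Out f x r" .
    have "belt C' O' g (belt C Out f x) r = belt C Out f x r"
    proof (rule belt_off)
      fix q assume "q \<in> act C' O' (belt C Out f x)"
      then have "q \<in> act C' O' x" using act_modified [OF modified_belt that(3)] by blast
      then obtain m t where q: "m \<in> C'" "cell x q m t" by (rule actE)
      obtain n s where p: "n \<in> C" "cell x p n s" using \<open>p \<in> act C Out x\<close> by (rule actE)
      have "p \<noteq> q" using p q cell_same [of x p n s m t] \<open>C \<inter> C' = {}\<close> by blast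
      then show "r \<noteq> q \<and> r \<noteq> q - 2"
        using cell_payload_unique [OF p(2) q(2) \<open>r = p \<or> r = p - 2\<close>] by blast
    qed
    with 1 show ?thesis by simp
  qed
  consider p where "r = p \<or> r = p - 2" "p \<in> act C Out x" | p where "r = p \<or> r = p - 2" "p \<in> act C' O' x"
    | "\<And>p. p \<in> act C Out x \<union> act C' O' x \<Longrightarrow> r \<noteq> p \<and> r \<noteq> p - 2" by blast
  then show "belt C Out f (belt C' O' g x) r = belt C' O' g (belt C Out f x) r"
  proof cases
    case 1
    then show ?thesis using sub assms by blast
  next
    case 2
    have "C' \<inter> C = {}" using assms(1) by blast
    then show ?thesis using sub [of C' C Out O' p g f] 2 assms by simp
  next
    case 3
    have "belt C Out f (belt C' O' g x) r = belt C' O' g x r"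
      by (rule belt_off) (use 3 act_modified [OF modified_belt assms(2)] in blast)
    also have "\<dots> = x r" by (rule belt_off) (use 3 in blast)
    also have "\<dots> = belt C Out f x r" by (rule belt_off [symmetric]) (use 3 in blast)
    also have "\<dots> = belt C' O' g (belt C Out f x) r"
      by (rule belt_off [symmetric]) (use 3 act_modified [OF modified_belt assms(3)] in blast)
    finally show ?thesis .
  qed
qed

section \<open>Belts commute with the shift\<close>

lemma ball_shift: "(\<forall>k\<in>{a..b::int}. P (k + 1)) \<longleftrightarrow> (\<forall>k\<in>{a + 1..b + 1}. P k)"
proof
  assume l: "\<forall>k\<in>{a..b}. P (k + 1)"
  have "P k" if "k \<in> {a + 1..b + 1}" for k
    using l [rule_format, of "k - 1"] that by auto
  then show "\<forall>k\<in>{a + 1..b + 1}. P k" by blast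
qed auto

lemma head_shift: "head (shift x) p n \<longleftrightarrow> head x (p + 1) n"
proof -
  have "p - int n - 7 + 1 = p + 1 - int n - 7" "p - int n - 6 + 1 = p + 1 - int n - 6"
    "p - int n - 5 + 1 = p + 1 - int n - 5" "p - 5 + 1 = p + 1 - 5" "p - 4 + 1 = p + 1 - 4"
    "p - 3 + 1 = p + 1 - 3" "p - 1 + 1 = p + 1 - 1" by simp_all
  then show ?thesis unfolding head_def shift_def ball_shift [where P = "\<lambda>k. x k = a0"] by (simp only:)
qed

lemma tail_shift: "tail (shift x) p s \<longleftrightarrow> tail x (p + 1) s"
proof -
  have "p + 2 + 1 = p + 1 + 2" "p + 3 + 1 = p + 1 + 3" "p + 4 + 1 = p + 1 + 4"
    "p + int s + 4 + 1 = p + 1 + int s + 4" "p + int s + 5 + 1 = p + 1 + int s + 5"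
    "p + int s + 6 + 1 = p + 1 + int s + 6" by simp_all
  then show ?thesis unfolding tail_def shift_def ball_shift [where P = "\<lambda>k. x k = a0"] by (simp only:)
qed

lemma cell_shift: "cell (shift x) p n s \<longleftrightarrow> cell x (p + 1) n s"
  by (simp add: cell_def head_shift tail_shift)

lemma enabled_shift: "enabled (shift x) p n \<longleftrightarrow> enabled x (p + 1) n"
proof -
  have *: "p - int n - int t - 14 + 1 = p + 1 - int n - int t - 14" for t by simp
  show ?thesis
    unfolding enabled_def tail_shift by (simp only: shift_def *)
qed

lemma act_shift: "p \<in> act C Out (shift x) \<longleftrightarrow> p + 1 \<in> act C Out x"
  by (simp add: act_def cell_shift enabled_shift)

lemma lnk_shift: "(p, q) \<in> lnk C Out (shift x) \<longleftrightarrow> (p + 1, q + 1) \<in> lnk C Out x"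
proof -
  have *: "q + 1 = p + 1 + int s + int m + 14 \<longleftrightarrow> q = p + int s + int m + 14" for s m by auto
  show ?thesis by (simp only: lnk_def act_shift cell_shift mem_Collect_eq prod.case *)
qed

lemma turn_shift:
  "turn (lnk C Out x) (fst \<sigma> + 1, snd \<sigma>) =
   (fst (turn (lnk C Out (shift x)) \<sigma>) + 1, snd (turn (lnk C Out (shift x)) \<sigma>))"
proof -
  obtain p b where \<sigma>: "\<sigma> = (p, b)" by (cases \<sigma>)
  note t = turn_cases [OF partial_inj_lnk [of C Out x]]
  note t' = turn_cases [OF partial_inj_lnk [of C Out "shift x"]]
  have d: "p + 1 \<notin> Domain (lnk C Out x)" if "p \<notin> Domain (lnk C Out (shift x))"
  proof
    assume "p + 1 \<in> Domain (lnk C Out x)"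
    then obtain q where "(p + 1, q - 1 + 1) \<in> lnk C Out x" by auto
    then show False using that unfolding lnk_shift [symmetric] by blast
  qed
  have r: "p + 1 \<notin> Range (lnk C Out x)" if "p \<notin> Range (lnk C Out (shift x))"
  proof
    assume "p + 1 \<in> Range (lnk C Out x)"
    then obtain q where "(q - 1 + 1, p + 1) \<in> lnk C Out x" by auto
    then show False using that unfolding lnk_shift [symmetric] by blast
  qed
  show ?thesis
  proof (cases b)
    case True
    show ?thesis
    proof (cases "p \<in> Domain (lnk C Out (shift x))")
      case True
      then obtain q where "(p, q) \<in> lnk C Out (shift x)" by blast
      then show ?thesis using \<open>b\<close> t(1) [of "p + 1" "q + 1"] t'(1) [of p q] by (simp add: \<sigma> lnk_shift)
    next
      case False
      then show ?thesis using \<open>b\<close> t(3) [OF d] t'(3) [of p] by (simp add: \<sigma>)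
    qed
  next
    case False
    show ?thesis
    proof (cases "p \<in> Range (lnk C Out (shift x))")
      case True
      then obtain q where "(q, p) \<in> lnk C Out (shift x)" by blast
      then show ?thesis using \<open>\<not> b\<close> t(2) [of "q + 1" "p + 1"] t'(2) [of q p] by (simp add: \<sigma> lnk_shift)
    next
      case False
      then show ?thesis using \<open>\<not> b\<close> t(4) [OF r] t'(4) [of p] by (simp add: \<sigma>)
    qed
  qed
qed

lemma orb_shift:
  "orb (lnk C Out x) k (fst \<sigma> + 1, snd \<sigma>) =
   (fst (orb (lnk C Out (shift x)) k \<sigma>) + 1, snd (orb (lnk C Out (shift x)) k \<sigma>))"
  by (rule orb_unique [OF partial_inj_lnk]) (simp_all add: orb_succ [OF partial_inj_lnk] turn_shift)

lemma cont_shift: "cont (shift x) \<sigma> = cont x (fst \<sigma> + 1, snd \<sigma>)"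
proof -
  have "fst \<sigma> - 2 + 1 = fst \<sigma> + 1 - 2" by simp
  then show ?thesis unfolding cont_def shift_def by (cases "snd \<sigma>") (simp_all only: fst_conv snd_conv if_True if_False)
qed

lemma upd_shift:
  "upd (lnk C Out (shift x)) (act C Out (shift x)) f (cont (shift x)) \<sigma> =
   upd (lnk C Out x) (act C Out x) f (cont x) (fst \<sigma> + 1, snd \<sigma>)"
  by (simp add: upd_def act_shift cont_shift orb_shift)

lemma belt_shift: "belt C Out f \<circ> shift = shift \<circ> belt C Out f"
proof (rule ext, rule ext)
  fix x :: "int \<Rightarrow> 'a" and r :: int
  have "r + 2 + 1 = r + 1 + 2" by simp
  then have "belt C Out f (shift x) r = belt C Out f x (r + 1)"
    unfolding belt_def upd_shift act_shift fst_conv snd_conv by (simp only: shift_def)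
  then show "(belt C Out f \<circ> shift) x r = (shift \<circ> belt C Out f) x r"
    by (simp add: shift_def)
qed

section \<open>Belts are continuous\<close>

lemma locdet_head: "locdet (\<lambda>x. head x p n)"
  unfolding head_def by (intro locdet_conj locdet_Ball locdet_eq) simp

lemma locdet_tail: "locdet (\<lambda>x. tail x p n)"
  unfolding tail_def by (intro locdet_conj locdet_Ball locdet_eq) simp

lemma locdet_cell: "locdet (\<lambda>x. cell x p n s)"
  unfolding cell_def by (intro locdet_conj locdet_head locdet_tail)

lemma locdet_enabled: "locdet (\<lambda>x. enabled x p n)"
proof (cases "cond n")
  case None
  then show ?thesis by (simp add: enabled_def locdet_const)
next
  case (Some ta)
  obtain t a where "ta = (t, a)" by (cases ta)
  with Some show ?thesis
    unfolding enabled_def by (simp only: option.case prod.case) (intro locdet_conj locdet_tail locdet_eq)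
qed

lemma locdet_act:
  assumes "finite C" "finite Out"
  shows "locdet (\<lambda>x. p \<in> act C Out x)"
  unfolding act_def mem_Collect_eq
  by (intro locdet_Bex locdet_conj locdet_cell locdet_enabled assms)

lemma locdet_lnk:
  assumes "finite C" "finite Out"
  shows "locdet (\<lambda>x. (p, q) \<in> lnk C Out x)"
  unfolding lnk_def mem_Collect_eq prod.case
  by (intro locdet_Bex locdet_conj locdet_cell locdet_act locdet_const assms)

text \<open>Finitely many codes and tags allow only finitely many distances between linked cells, so
  only a finite set \<open>?D\<close> of candidates has to be inspected.\<close>

lemma locdet_lnk_Image:
  assumes "finite C" "finite Out"
  shows "locdet (\<lambda>x. lnk C Out x `` {p})" "locdet (\<lambda>x. (lnk C Out x)\<inverse> `` {p})"
proof -
  let ?D = "(\<lambda>(s, m). p + int s + int m + 14) ` (Out \<times> C)"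
  have "lnk C Out x `` {p} = {q \<in> ?D. (p, q) \<in> lnk C Out x}" for x
    by (auto simp: lnk_def)
  then show "locdet (\<lambda>x. lnk C Out x `` {p})"
    using locdet_Collect [of ?D "\<lambda>x q. (p, q) \<in> lnk C Out x"] assms by (simp add: locdet_lnk)
  let ?D = "(\<lambda>(s, m). p - int s - int m - 14) ` (Out \<times> C)"
  have "(lnk C Out x)\<inverse> `` {p} = {q \<in> ?D. (q, p) \<in> lnk C Out x}" for x
  proof -
    have "q \<in> ?D" if "(q, p) \<in> lnk C Out x" for q
    proof -
      obtain s m where "s \<in> Out" "m \<in> C" "p = q + int s + int m + 14"
        using \<open>(q, p) \<in> lnk C Out x\<close> unfolding lnk_def by blast
      then show ?thesis by (intro image_eqI [of _ _ "(s, m)"]) auto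
    qed
    then show ?thesis by blast
  qed
  then show "locdet (\<lambda>x. (lnk C Out x)\<inverse> `` {p})"
    using locdet_Collect [of ?D "\<lambda>x q. (q, p) \<in> lnk C Out x"] assms by (simp add: locdet_lnk)
qed

lemma locdet_upd:
  assumes "finite C" "finite Out" "f \<in> carrier Aut_full_shift"
  shows "locdet (\<lambda>x. upd (lnk C Out x) (act C Out x) f (cont x) \<sigma>)"
proof -
  have "locdet (\<lambda>x. cont x (orb (lnk C Out x) k \<sigma>))" for k
    by (rule locdet_bind [OF locdet_orb, where k = "\<lambda>\<sigma> x. cont x \<sigma>"])
       (simp_all only: cont_def locdet_eval locdet_lnk_Image [OF assms(1,2)])
  then show ?thesis
    unfolding upd_def
    by (intro locdet_if locdet_act locdet_seq [OF Aut_locdet [OF assms(3)]] assms)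
       (simp_all only: cont_def locdet_eval)
qed

lemma belt_Aut:
  assumes "finite C" "finite Out" "reads C \<inter> Out = {}" "f \<in> carrier Aut_full_shift"
  shows "belt C Out f \<in> carrier Aut_full_shift"
proof -
  interpret group "Aut_full_shift :: ((int \<Rightarrow> 'a) \<Rightarrow> int \<Rightarrow> 'a) monoid"
    by (rule group_Aut_full_shift)
  obtain g where g: "g \<in> carrier Aut_full_shift" "f \<circ> g = id" "g \<circ> f = id"
    using inv_closed [OF assms(4)] r_inv [OF assms(4)] l_inv [OF assms(4)]
    unfolding Aut_simps by blast
  have l: "locdet (\<lambda>x. belt C Out f x r)" if "f \<in> carrier Aut_full_shift" for f r
    unfolding belt_def
    by (intro locdet_if locdet_act locdet_upd locdet_eval assms(1,2) that)
  show ?thesis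
  proof (rule Aut_full_shiftI)
    show "locdet (\<lambda>x. belt C Out f x r)" "locdet (\<lambda>x. belt C Out g x r)" for r
      using l assms(4) g(1) by blast+
    show "belt C Out f \<circ> belt C Out g = id" "belt C Out g \<circ> belt C Out f = id"
      by (rule ext; simp add: belt_comp [OF assms(3)] g assms(4) belt_id)+
    show "belt C Out f \<circ> shift = shift \<circ> belt C Out f"
      by (rule belt_shift)
  qed
qed

end

section \<open>Finite chains\<close>

text \<open>Cells are numbered from the right end \<open>P\<close>, where the effect is observed.
  Cutting off the leftmost cell then changes only \<open>M\<close>, not the numbering.\<close>

definition chain_set :: "int \<Rightarrow> int \<Rightarrow> nat \<Rightarrow> int set" where
  "chain_set d P M = (\<lambda>k. P - int k * d) ` {..<M}"

definition chain_rel :: "int \<Rightarrow> int \<Rightarrow> nat \<Rightarrow> (int \<times> int) set" where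
  "chain_rel d P M = (\<lambda>k. (P - int (Suc k) * d, P - int k * d)) ` {k. Suc k < M}"

lemma chain_rel_subset: "chain_rel d P M \<subseteq> chain_set d P M \<times> chain_set d P M"
  unfolding chain_rel_def chain_set_def by force

lemma partial_inj_chain:
  assumes "d > 0"
  shows "partial_inj (chain_rel d P M)"
proof -
  have "single_valued (chain_rel d P M)"
  proof (rule single_valuedI)
    fix p q q' assume "(p, q) \<in> chain_rel d P M" "(p, q') \<in> chain_rel d P M"
    then obtain k l where "p = P - int (Suc k) * d" "q = P - int k * d"
      "p = P - int (Suc l) * d" "q' = P - int l * d" unfolding chain_rel_def by blast
    then show "q = q'" using assms by simp
  qed
  moreover have "single_valued ((chain_rel d P M)\<inverse>)"
  proof (rule single_valuedI)
    fix p q q' assume "(p, q) \<in> (chain_rel d P M)\<inverse>" "(p, q') \<in> (chain_rel d P M)\<inverse>"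
    then obtain k l where "q = P - int (Suc k) * d" "p = P - int k * d"
      "q' = P - int (Suc l) * d" "p = P - int l * d" unfolding chain_rel_def by blast
    then show "q = q'" using assms by simp
  qed
  ultimately show ?thesis by (simp add: partial_inj_def)
qed

text \<open>A cyclic enumeration of the \<open>2 * M\<close> slots: from the lower slot of
  \<open>P\<close> leftwards to the end, then back through the upper slots. The upper slot of
  \<open>P\<close> comes last, with index \<open>-1\<close> modulo \<open>2 * M\<close>, which
  causes the shift by one in \<open>orb_chain\<close>.\<close>

definition chain_slot :: "int \<Rightarrow> int \<Rightarrow> nat \<Rightarrow> int \<Rightarrow> int \<times> bool" where
  "chain_slot d P M j =
     (if j < int M then (P - j * d, False) else (P - (2 * int M - 1 - j) * d, True))"

lemma turn_chain_slot:
  assumes "d > 0" "M > 0" "0 \<le> j" "j < 2 * int M"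
  shows "turn (chain_rel d P M) (chain_slot d P M j) = chain_slot d P M ((j + 1) mod (2 * int M))"
proof -
  let ?R = "chain_rel d P M"
  note t = turn_cases [OF partial_inj_chain [OF assms(1), of P M]]
  have R: "(P - (k + 1) * d, P - k * d) \<in> ?R" if "0 \<le> k" "k + 1 < int M" for k
  proof -
    have "int (nat k) = k" "Suc (nat k) < M" using that by auto
    then show ?thesis unfolding chain_rel_def by (intro image_eqI [of _ _ "nat k"]) auto
  qed
  have i: "k = l" if "P - k * d = P - l * d" for k l
    using that assms(1) by simp
  have dom: "P - 0 * d \<notin> Domain ?R"
  proof
    assume "P - 0 * d \<in> Domain ?R"
    then obtain k where "P - 0 * d = P - int (Suc k) * d" by (auto simp: chain_rel_def)
    from i [OF this] show False by simp
  qed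
  have rng: "P - (int M - 1) * d \<notin> Range ?R"
  proof
    assume "P - (int M - 1) * d \<in> Range ?R"
    then obtain k where "P - (int M - 1) * d = P - int k * d" "Suc k < M" by (auto simp: chain_rel_def)
    with i [OF this(1)] show False by simp
  qed
  consider "j < int M - 1" | "j = int M - 1" | "int M \<le> j" "j < 2 * int M - 1" | "j = 2 * int M - 1"
    using assms(4) by linarith
  then show ?thesis
  proof cases
    case 1
    then show ?thesis
      using t(2) [OF R [of j]] assms(3) by (simp add: chain_slot_def)
  next
    case 2
    have "(j + 1) mod (2 * int M) = int M" using 2 assms(2) by simp
    then show ?thesis
      using t(4) [OF rng] 2 by (simp add: chain_slot_def)
  next
    case 3
    then have "(j + 1) mod (2 * int M) = j + 1" using assms(3) by simp
    moreover have "chain_slot d P M j = (P - (2 * int M - 2 - j + 1) * d, True)"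
      using 3 by (simp add: chain_slot_def)
    moreover have "chain_slot d P M (j + 1) = (P - (2 * int M - 2 - j) * d, True)"
    proof -
      have "2 * int M - 1 - (j + 1) = 2 * int M - 2 - j" by simp
      then show ?thesis using 3 unfolding chain_slot_def by simp
    qed
    moreover have "turn ?R (P - (2 * int M - 2 - j + 1) * d, True) = (P - (2 * int M - 2 - j) * d, True)"
      by (rule t(1) [OF R]) (use 3 in auto)
    ultimately show ?thesis by (simp only:)
  next
    case 4
    then have "(j + 1) mod (2 * int M) = 0" by simp
    then show ?thesis
      using t(3) [OF dom] 4 assms(2) by (simp add: chain_slot_def)
  qed
qed

lemma orb_chain:
  assumes "d > 0" "M > 0"
  shows "orb (chain_rel d P M) k (P, True) = chain_slot d P M ((k - 1) mod (2 * int M))"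
proof (rule orb_unique [OF partial_inj_chain [OF assms(1)]])
  have "(0 - 1) mod (2 * int M) = 2 * int M - 1"
    using assms(2) by (simp add: zmod_minus1)
  then show "chain_slot d P M ((0 - 1) mod (2 * int M)) = (P, True)"
    using assms(2) by (simp add: chain_slot_def)
  fix k
  have "((k - 1) mod (2 * int M) + 1) mod (2 * int M) = (k + 1 - 1) mod (2 * int M)"
    by (simp add: mod_add_left_eq)
  then show "chain_slot d P M ((k + 1 - 1) mod (2 * int M)) =
      turn (chain_rel d P M) (chain_slot d P M ((k - 1) mod (2 * int M)))"
    using turn_chain_slot [OF assms, of "(k - 1) mod (2 * int M)" P] assms(2) by simp
qed

text \<open>The value of \<open>f\<close> at \<open>0\<close> depends on a finite window, and the
  contents of this window can be repeated periodically. The period is even because a chain has two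
  slots per cell.\<close>

lemma moved_periodic_point:
  assumes "f \<in> carrier Aut_full_shift" "f \<noteq> id"
  obtains M :: nat and z where "\<And>k. z (k + 2 * int (Suc M)) = z k" "f z 0 \<noteq> z 0"
proof -
  obtain x r where x: "f x r \<noteq> x r" using assms(2) by (auto simp: fun_eq_iff)
  define y where "y = (\<lambda>i. x (i + r))"
  have y: "f y 0 \<noteq> y 0" using x Aut_shift [OF assms(1), of x r 0] by (simp add: y_def)
  obtain J where J: "finite J" "\<And>z. \<forall>j\<in>J. z j = y j \<Longrightarrow> f z 0 = f y 0"
    by (rule locdetE [OF Aut_locdet [OF assms(1)], where x = y]) blast
  define B where "B = Max (abs ` J)"
  have B: "\<bar>j\<bar> \<le> B" if "j \<in> J" for j
    unfolding B_def by (rule Max_ge) (use that J(1) in auto)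
  \<comment> \<open>\<open>J\<close> may be empty, and then \<open>Max\<close> is unspecified; the
    absolute value gives a usable radius in every case.\<close>
  define M where "M = nat \<bar>B\<bar>"
  \<comment> \<open>The fundamental domain runs from \<open>- Suc M\<close> to \<open>M\<close> and
    contains the whole window.\<close>
  define z where "z = (\<lambda>k. y ((k + int (Suc M)) mod (2 * int (Suc M)) - int (Suc M)))"
  have z: "z j = y j" if "\<bar>j\<bar> \<le> int M" for j
  proof -
    have "(j + int (Suc M)) mod (2 * int (Suc M)) = j + int (Suc M)"
      using that by (intro mod_pos_pos_trivial) auto
    then show ?thesis by (simp add: z_def)
  qed
  have "z j = y j" if "j \<in> J" for j
  proof (rule z)
    have "int M = \<bar>B\<bar>" by (simp add: M_def)
    then show "\<bar>j\<bar> \<le> int M" using B [OF that] by linarith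
  qed
  then have "f z 0 = f y 0" using J(2) by blast
  moreover have "z 0 = y 0" by (rule z) simp
  moreover have "z (k + 2 * int (Suc M)) = z k" for k
  proof -
    have "(k + 2 * int (Suc M) + int (Suc M)) mod (2 * int (Suc M)) = (k + int (Suc M)) mod (2 * int (Suc M))"
      by (metis add.commute add.left_commute mod_add_self2)
    then show ?thesis by (simp only: z_def)
  qed
  ultimately show ?thesis using that y by metis
qed

text \<open>A chain of \<open>M\<close> cells is a cycle of length \<open>2 * M\<close>, on which \<open>f\<close> acts as on the points of that period.
  Take the shortest chain on which \<open>f\<close> is not trivial: cutting off the cell farthest from \<open>P\<close>
  makes \<open>f\<close> trivial, which is visible at \<open>P\<close>.\<close>

lemma chain_detects:
  assumes f: "f \<in> carrier Aut_full_shift" "f \<noteq> id"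
  shows "\<exists>N. \<forall>P d. d > 0 \<longrightarrow> (\<exists>c.
    upd (chain_rel d P (Suc N)) (chain_set d P (Suc N)) f c (P, True) \<noteq>
    upd (chain_rel d P N) (chain_set d P N) f c (P, True))"
proof -
  \<comment> \<open>\<open>Q M\<close> concerns chains of \<open>Suc M\<close> cells, which excludes
    the empty cycle; the shortest chain on which \<open>f\<close> is not trivial thus has
    \<open>Suc N\<close> cells.\<close>
  define Q where "Q = (\<lambda>M. \<exists>z. (\<forall>k. z (k + 2 * int (Suc M)) = z k) \<and> f z 0 \<noteq> z 0)"
  define N where "N = (LEAST M. Q M)"
  have "\<exists>M. Q M" using moved_periodic_point [OF f] unfolding Q_def by metis
  then have "Q N" unfolding N_def by (rule LeastI_ex)
  have least: "\<not> Q m" if "m < N" for m using that not_less_Least unfolding N_def by blast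
  obtain z where z: "\<And>k. z (k + 2 * int (Suc N)) = z k" "f z 0 \<noteq> z 0"
    using \<open>Q N\<close> unfolding Q_def by blast
  show ?thesis
  proof (intro exI allI impI)
    fix P d :: int assume d: "d > 0"
    \<comment> \<open>This writes \<open>z\<close> along the cycle of the long chain, with index
      \<open>0\<close> at the upper slot of \<open>P\<close> and index \<open>1\<close> at its lower
      slot. Going left, upper slots take indices down from \<open>0\<close> and lower slots take
      indices up from \<open>1\<close>.\<close>
    define c where "c = (\<lambda>(p, b). z (if b then - ((P - p) div d) else (P - p) div d + 1))"
    have c1: "c (P - j * d, b) = z (if b then - j else j + 1)" for j b
      using d by (simp add: c_def)
    have c0: "c (P, True) = z 0" using c1 [of 0 True] by simp
    have P: "P \<in> chain_set d P (Suc M)" for M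
      unfolding chain_set_def by (rule image_eqI [of _ _ 0]) auto
    have "c (orb (chain_rel d P (Suc N)) k (P, True)) = z k" for k
    proof -
      define L where "L = 2 * int (Suc N)"
      define j where "j = (k - 1) mod L"
      have per: "z (i + l * L) = z i" for i l
      proof (induction l rule: int_induct [where k = 0])
        case (step1 l)
        then show ?case using z(1) [of "i + l * L"] by (simp add: L_def algebra_simps)
      next
        case (step2 l)
        then show ?case using z(1) [of "i + (l - 1) * L"] by (simp add: L_def algebra_simps)
      qed simp
      have k: "k = j + 1 + ((k - 1) div L) * L"
        unfolding j_def using mult_div_mod_eq [of L "k - 1"] by (simp add: algebra_simps)
      have "z k = z (j + 1)" by (subst k) (rule per)
      moreover have "z (j + 1 - L) = z (j + 1)" using per [of "j + 1" "- 1"] by simp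
      moreover have "- (2 * int (Suc N) - 1 - j) = j + 1 - L" by (simp add: L_def)
      moreover have "orb (chain_rel d P (Suc N)) k (P, True) = chain_slot d P (Suc N) j"
        unfolding j_def L_def by (rule orb_chain [OF d]) simp
      ultimately show ?thesis
        using c1 [of j False] c1 [of "2 * int (Suc N) - 1 - j" True]
        by (cases "j < int (Suc N)") (simp_all only: chain_slot_def if_True if_False)
    qed
    then have 1: "upd (chain_rel d P (Suc N)) (chain_set d P (Suc N)) f c (P, True) = f z 0"
      using P by (simp add: upd_def)
    \<comment> \<open>For \<open>N = 0\<close> the cell cut off is \<open>P\<close> itself; the
      short chain is empty and \<open>P\<close> keeps its symbol.\<close>
    have 2: "upd (chain_rel d P N) (chain_set d P N) f c (P, True) = z 0"
    proof (cases N)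
      case 0
      then show ?thesis by (simp add: upd_def chain_set_def c0)
    next
      case (Suc M)
      define y where "y = (\<lambda>k. c (orb (chain_rel d P N) k (P, True)))"
      have "N > 0" using Suc by simp
      then have y: "y k = c (chain_slot d P N ((k - 1) mod (2 * int N)))" for k
        by (simp only: y_def orb_chain [OF d])
      have "(k + 2 * int N - 1) mod (2 * int N) = (k - 1) mod (2 * int N)" for k
        by (metis add_diff_eq diff_add_eq mod_add_self2)
      then have "y (k + 2 * int (Suc M)) = y k" for k
        unfolding y Suc by simp
      then have "f y 0 = y 0" using least [of M] Suc unfolding Q_def by auto
      moreover have "y 0 = z 0" by (simp add: y_def c0)
      ultimately show ?thesis using P [of M] Suc by (simp add: upd_def y_def)
    qed
    show "upd (chain_rel d P (Suc N)) (chain_set d P (Suc N)) f c (P, True) \<noteq>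
        upd (chain_rel d P N) (chain_set d P N) f c (P, True)"
      unfolding 1 2 by (rule z(2))
  qed
qed

section \<open>Zones: finite blocks of cells whose first cell is conditional\<close>

context cell_code
begin

text \<open>The symbol at \<open>r\<close> may be rewritten, but the tail to its right may not: by
  \<open>tail_tail\<close>, a cell with payload there would have its payload address at
  \<open>r\<close> itself. In contrast to \<open>enabled_modified_imp\<close>, this holds for all
  tags.\<close>

lemma tail_modified:
  assumes "modified C' O' x y" "tail x r t" "cell x (r + int t + int n + 14) n s"
  shows "tail y r t"
proof (rule tail_agree [OF assms(2)], rule ccontr)
  fix k assume k: "r < k" "k \<le> r + int t + 6" "y k \<noteq> x k"
  then obtain q m u where q: "cell x q m u" "k = q \<or> k = q - 2"
    using assms(1) unfolding modified_def by blast
  have "q + int u + 6 < r + int t + 7"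
    using cell_disjoint [OF assms(3) q(1)] q(2) k(2) by auto
  moreover have "r < q" using k q(2) by auto
  ultimately show False
    using tail_tail [OF assms(2), of q u] q(1) by (auto simp: cell_def)
qed

text \<open>The hypotheses \<open>left\<close> and \<open>right\<close> prevent the belt from
  continuing beyond the zone. Inside it, the belt is a finite chain, and the condition of the
  leftmost cell decides between \<open>N\<close> and \<open>Suc N\<close> cells. All distances equal
  \<open>d\<close> because every cell except the leftmost has code \<open>n1\<close>.\<close>

lemma belt_zone:
  assumes C: "n0 \<in> C" "n1 \<in> C" "cond n1 = None" and s: "s \<in> Out" and d: "d = int s + int n1 + 14"
    and cells: "\<And>k. k < N \<Longrightarrow> cell Y (P - int k * d) n1 s" "cell Y (P - int N * d) n0 s"
    and left: "\<And>p m t. m \<in> C \<Longrightarrow> t \<in> Out \<Longrightarrow> cell Y p m t \<Longrightarrow> p + int t + int n0 + 14 \<noteq> P - int N * d"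
    and right: "\<And>m t. m \<in> C \<Longrightarrow> \<not> cell Y (P + int s + int m + 14) m t"
    and M: "M = (if enabled Y (P - int N * d) n0 then Suc N else N)"
    and c: "\<And>k b. k \<le> N \<Longrightarrow> cont Y (P - int k * d, b) = c (P - int k * d, b)"
    and k: "k \<le> N"
  shows "cont (belt C Out f Y) (P - int k * d, b) =
    upd (chain_rel d P M) (chain_set d P M) f c (P - int k * d, b)"
proof -
  let ?p = "\<lambda>k. P - int k * d"
  let ?S = "chain_set d P M"
  have d0: "d > 0" by (simp add: d)
  have act: "?p k \<in> act C Out Y \<longleftrightarrow> k < M" if "k \<le> N" for k
  proof (cases "k = N")
    case True
    have "?p N \<in> act C Out Y \<longleftrightarrow> enabled Y (?p N) n0"
      using cells(2) C(1) s cell_same [OF cells(2)] unfolding act_def by blast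
    then show ?thesis using True M by simp
  next
    case False
    then have "k < N" using that by simp
    moreover have "enabled Y (?p k) n1" using C(3) by (simp add: enabled_def)
    ultimately show ?thesis using cells(1) C(2) s M by (auto simp: act_def)
  qed
  have S: "?p k \<in> ?S \<longleftrightarrow> k < M" for k
    using d0 by (auto simp: chain_set_def)
  have MN: "M \<le> Suc N" using M by auto
  have code: "\<exists>n\<in>C. cell Y (?p k) n s" if "k \<le> N" for k
  proof (cases "k = N")
    case True
    then show ?thesis using cells(2) C(1) by blast
  next
    case False
    then have "k < N" using that by simp
    then show ?thesis using cells(1) C(2) by blast
  qed
  have step: "?p k = ?p (Suc k) + d" for k by (simp add: algebra_simps)
  \<comment> \<open>A link that touches the chain is internal. It cannot enter the conditional cell
    from the left by \<open>left\<close>, nor leave \<open>P\<close> by \<open>right\<close>;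
    elsewhere the neighbour is determined because cells do not overlap.\<close>
  have L: "\<exists>k. Suc k < M \<and> p = ?p (Suc k) \<and> q = ?p k"
    if pq: "(p, q) \<in> lnk C Out Y" and S': "p \<in> ?S \<or> q \<in> ?S" for p q
  proof -
    obtain n u m t where l: "n \<in> C" "u \<in> Out" "m \<in> C" "cell Y p n u" "cell Y q m t" "q = p + int u + int m + 14"
      using pq unfolding lnk_def by blast
    show ?thesis
    proof (cases "q \<in> ?S")
      case True
      then obtain k where k: "k < M" "q = ?p k" by (auto simp: chain_set_def)
      have "k \<noteq> N"
      proof
        assume "k = N"
        then have "m = n0" using cells(2) l(5) k(2) cell_same by blast
        then show False using left [OF l(1,2,4)] l(6) k(2) \<open>k = N\<close> by simp
      qed
      then have kN: "k < N" using k(1) MN by simp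
      then have "m = n1" using cells(1) l(5) k(2) cell_same by blast
      then have e: "p + int u = ?p (Suc k) + int s"
        using l(6) k(2) step [of k] d by simp
      obtain n' where "cell Y (?p (Suc k)) n' s" using code [of "Suc k"] kN by auto
      then have p: "p = ?p (Suc k)"
        using cell_disjoint [OF l(4)] e by fastforce
      moreover have "p \<in> act C Out Y" using pq by (simp add: lnk_def)
      then have "Suc k < M" using act [of "Suc k"] kN p by simp
      ultimately show ?thesis using k(2) by blast
    next
      case False
      then have "p \<in> ?S" using S' by blast
      then obtain k where k: "k < M" "p = ?p k" by (auto simp: chain_set_def)
      have "k \<le> N" using k(1) MN by simp
      then have u: "u = s" using code [of k] k(2) l(4) cell_same by blast
      show ?thesis
      proof (cases k)
        case 0
        then show ?thesis using right [OF l(3), of t] l(5,6) u k(2) by simp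
      next
        case (Suc k')
        then have "cell Y (?p k') n1 s" using cells(1) \<open>k \<le> N\<close> by simp
        moreover have "q - int m = ?p k' - int n1"
          using l(6) u k(2) step [of k'] Suc d by simp
        ultimately have "q = ?p k'" using cell_unique [OF l(5)] by blast
        then show ?thesis using k Suc by blast
      qed
    qed
  qed
  have cl: "p \<in> ?S \<longleftrightarrow> q \<in> ?S" if pq: "(p, q) \<in> lnk C Out Y" for p q
  proof
    assume "p \<in> ?S"
    then show "q \<in> ?S" using L [OF pq] S by fastforce
  next
    assume "q \<in> ?S"
    then show "p \<in> ?S" using L [OF pq] S by fastforce
  qed
  have K: "lnk C Out Y \<inter> ?S \<times> ?S = chain_rel d P M"
  proof
    show "lnk C Out Y \<inter> ?S \<times> ?S \<subseteq> chain_rel d P M"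
    proof clarify
      fix p q assume "(p, q) \<in> lnk C Out Y" "p \<in> ?S"
      then obtain k where "Suc k < M" "p = ?p (Suc k)" "q = ?p k" using L by blast
      then show "(p, q) \<in> chain_rel d P M" unfolding chain_rel_def by blast
    qed
    show "chain_rel d P M \<subseteq> lnk C Out Y \<inter> ?S \<times> ?S"
    proof
      fix pq assume "pq \<in> chain_rel d P M"
      then obtain k where k: "Suc k < M" "pq = (?p (Suc k), ?p k)" by (auto simp: chain_rel_def)
      have kN: "Suc k \<le> N" "k < N" using k(1) MN by auto
      obtain n where n: "n \<in> C" "cell Y (?p (Suc k)) n s" using code [OF kN(1)] by blast
      have "cell Y (?p k) n1 s" using cells(1) kN by blast
      moreover have "?p k = ?p (Suc k) + int s + int n1 + 14" using step [of k] d by simp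
      moreover have "?p (Suc k) \<in> act C Out Y" "?p k \<in> act C Out Y"
        using act [OF kN(1)] act [of k] kN(2) k(1) by auto
      ultimately have "(?p (Suc k), ?p k) \<in> lnk C Out Y"
        using n C(2) s unfolding lnk_def mem_Collect_eq prod.case by blast
      then show "pq \<in> lnk C Out Y \<inter> ?S \<times> ?S" using k S [of k] S [of "Suc k"] by simp
    qed
  qed
  have sub: "?S \<subseteq> act C Out Y" using act MN by (auto simp: chain_set_def)
  obtain n where n: "cell Y (?p k) n s" using code [OF k] by blast
  show ?thesis
  proof (cases "k < M")
    case True
    have "cont (belt C Out f Y) (?p k, b) = upd (lnk C Out Y) (act C Out Y) f (cont Y) (?p k, b)"
      by (rule cont_belt [OF n])
    also have "\<dots> = upd (lnk C Out Y \<inter> ?S \<times> ?S) ?S f c (?p k, b)"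
    proof (rule upd_restrict [OF partial_inj_lnk cl sub])
      show "fst (?p k, b) \<in> ?S" using S True by simp
      fix \<tau> :: "int \<times> bool" assume "fst \<tau> \<in> ?S"
      then obtain l where "l < M" "\<tau> = (?p l, snd \<tau>)" by (cases \<tau>) (auto simp: chain_set_def)
      then show "cont Y \<tau> = c \<tau>" using c [of l "snd \<tau>"] MN by simp
    qed
    finally show ?thesis unfolding K .
  next
    case False
    then have "?p k \<notin> act C Out Y" using act k by simp
    then have "cont (belt C Out f Y) (?p k, b) = cont Y (?p k, b)"
      unfolding cont_belt [OF n] by (simp add: upd_def)
    then show ?thesis using c [OF k] S [of k] False by (simp add: upd_def)
  qed
qed

lemma append_cell:
  obtains X where "\<And>k. k < e \<Longrightarrow> X k = X' k" "cell X (e + int n + 7) n s" "\<And>b. cont X (e + int n + 7, b) = c b"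
proof -
  define p where "p = e + int n + 7"
  define X where "X = (\<lambda>k. if k < e then X' k else if k = p then c True else if k = p - 2 then c False
    else if k \<in> {p - int n - 7, p - int n - 6, p - 4, p + 3, p + int s + 5} then a1 else a0)"
  have "cell X p n s"
    unfolding cell_def head_def tail_def X_def p_def by auto
  moreover have "cont X (p, b) = c b" for b
    unfolding cont_def X_def p_def by auto
  moreover have "X k = X' k" if "k < e" for k using that by (simp add: X_def)
  ultimately show ?thesis using that unfolding p_def by blast
qed

text \<open>Cells are appended on the right, hence the numbering from the left end \<open>q\<close>,
  opposite to that of \<open>chain_set\<close>.\<close>

lemma build_zone:
  assumes d: "d = int s + int n1 + 14" and q: "q = e + int n0 + 7"
  shows "\<exists>X. (\<forall>k<e. X k = X' k) \<and> cell X q n0 s \<and> (\<forall>k<N. cell X (q + int (Suc k) * d) n1 s) \<and>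
     (\<forall>k\<le>N. \<forall>b. cont X (q + int k * d, b) = c (q + int k * d, b))"
proof (induction N)
  case 0
  obtain X where "\<And>k. k < e \<Longrightarrow> X k = X' k" "cell X q n0 s" "\<And>b. cont X (q, b) = c (q, b)"
    using append_cell [of e X' n0 s "\<lambda>b. c (q, b)"] unfolding q by metis
  then show ?case by (intro exI [of _ X]) auto
next
  case (Suc N)
  then obtain X where X: "\<And>k. k < e \<Longrightarrow> X k = X' k" "cell X q n0 s"
    "\<And>k. k < N \<Longrightarrow> cell X (q + int (Suc k) * d) n1 s"
    "\<And>k b. k \<le> N \<Longrightarrow> cont X (q + int k * d, b) = c (q + int k * d, b)" by blast
  \<comment> \<open>The first position after the last cell built so far.\<close>
  define e' where "e' = q + int N * d + int s + 7"
  have q': "e' + int n1 + 7 = q + int (Suc N) * d" by (simp add: e'_def d algebra_simps)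
  obtain Z where Z: "\<And>k. k < e' \<Longrightarrow> Z k = X k" "cell Z (q + int (Suc N) * d) n1 s"
    "\<And>b. cont Z (q + int (Suc N) * d, b) = c (q + int (Suc N) * d, b)"
    using append_cell [of e' X n1 s "\<lambda>b. c (q + int (Suc N) * d, b)"] unfolding q' by metis
  have d0: "d > 0" by (simp add: d)
  have mono: "q + int k * d \<le> q + int N * d" if "k \<le> N" for k
    using that d0 by simp
  have nn: "0 \<le> int N * d" using d0 by simp
  have "\<forall>k<e. Z k = X' k" using Z(1) X(1) nn by (simp add: e'_def q)
  moreover have "cell Z q n0 s"
    by (rule cell_agree [OF X(2)]) (use nn in \<open>auto intro!: Z(1) simp: e'_def\<close>)
  moreover have "cell Z (q + int (Suc k) * d) n1 s" if "k < Suc N" for k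
  proof (cases "k = N")
    case False
    then have "k < N" using that by simp
    moreover have "q + int (Suc k) * d \<le> q + int N * d" using mono [of "Suc k"] \<open>k < N\<close> by simp
    ultimately show ?thesis
      by (intro cell_agree [OF X(3)]) (auto intro!: Z(1) simp: e'_def)
  qed (use Z(2) in simp)
  moreover have "cont Z (q + int k * d, b) = c (q + int k * d, b)" if "k \<le> Suc N" for k b
  proof (cases "k = Suc N")
    case False
    then have "k \<le> N" using that by simp
    then have "cont Z (q + int k * d, b) = cont X (q + int k * d, b)"
      using mono [of k] unfolding cont_def by (intro Z(1)) (simp add: e'_def)
    then show ?thesis using X(4) \<open>k \<le> N\<close> by simp
  qed (use Z(3) in simp)
  ultimately show ?case by blast
qed

end

section \<open>Reduced words act nontrivially\<close>

text \<open>With \<open>m\<close> empty this forbids consecutive letters of one vertex. In general,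
  no two letters of a vertex can be brought together by exchanging commuting letters.\<close>

definition reduced_word ::
    "('v \<Rightarrow> 'v \<Rightarrow> bool) \<Rightarrow> ('v \<Rightarrow> ('g, 'm) monoid_scheme) \<Rightarrow> ('v \<times> 'g) list \<Rightarrow> bool" where
  "reduced_word nc G w \<longleftrightarrow> (\<forall>p\<in>set w. snd p \<noteq> \<one>\<^bsub>G (fst p)\<^esub>) \<and>
     (\<forall>u i g m h v. w = u @ (i, g) # m @ (i, h) # v \<longrightarrow> (\<exists>p\<in>set m. nc i (fst p)))"

text \<open>\<open>reads_Out\<close> includes \<open>i = j\<close>, so a belt does not influence
  itself. \<open>channel\<close> is the opposite requirement for nonadjacent vertices; conditions
  for every symbol are demanded because the symbol to be tested is known only during the induction.
  The tag in \<open>own_channel\<close> serves the base case.\<close>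

locale cell_family = cell_code a0 a1 cond
  for a0 a1 :: "'a::finite" and cond :: "nat \<Rightarrow> (nat \<times> 'a) option" +
  fixes V :: "'v set" and nc :: "'v \<Rightarrow> 'v \<Rightarrow> bool" and C Out :: "'v \<Rightarrow> nat set"
    and G :: "'v \<Rightarrow> ('g, 'm) monoid_scheme" and \<phi> :: "'v \<Rightarrow> 'g \<Rightarrow> (int \<Rightarrow> 'a) \<Rightarrow> int \<Rightarrow> 'a"
  assumes fin: "i \<in> V \<Longrightarrow> finite (C i)" "i \<in> V \<Longrightarrow> finite (Out i)"
    and C_disjoint: "i \<in> V \<Longrightarrow> j \<in> V \<Longrightarrow> i \<noteq> j \<Longrightarrow> C i \<inter> C j = {}"
    and reads_Out: "i \<in> V \<Longrightarrow> j \<in> V \<Longrightarrow> \<not> nc i j \<Longrightarrow> reads (C i) \<inter> Out j = {}"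
    and nc_irrefl: "\<not> nc i i"
    and nc_sym: "nc i j \<Longrightarrow> nc j i"
    and channel: "i \<in> V \<Longrightarrow> j \<in> V \<Longrightarrow> nc i j \<Longrightarrow> \<exists>t\<in>Out j. \<forall>a. \<exists>n\<in>C i. cond n = Some (t, a)"
    and own_channel: "i \<in> V \<Longrightarrow> \<exists>t. \<forall>a. \<exists>n\<in>C i. cond n = Some (t, a)"
    and unconditional: "i \<in> V \<Longrightarrow> \<exists>n\<in>C i. cond n = None"
    and Out_nonempty: "i \<in> V \<Longrightarrow> Out i \<noteq> {}"
    and group_G: "i \<in> V \<Longrightarrow> group (G i)"
    and hom_\<phi>: "i \<in> V \<Longrightarrow> \<phi> i \<in> hom (G i) Aut_full_shift"
    and inj_\<phi>: "i \<in> V \<Longrightarrow> inj_on (\<phi> i) (carrier (G i))"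
begin

section \<open>The action of words\<close>

definition rho :: "'v \<Rightarrow> 'g \<Rightarrow> (int \<Rightarrow> 'a) \<Rightarrow> int \<Rightarrow> 'a" where
  "rho i g = belt (C i) (Out i) (\<phi> i g)"

primrec ev :: "('v \<times> 'g) list \<Rightarrow> (int \<Rightarrow> 'a) \<Rightarrow> int \<Rightarrow> 'a" where
  "ev [] = id"
| "ev (p # w) = rho (fst p) (snd p) \<circ> ev w"

lemma ev_append: "ev (u @ w) = ev u \<circ> ev w"
  by (induction u) auto

lemma \<phi>_Aut: "i \<in> V \<Longrightarrow> g \<in> carrier (G i) \<Longrightarrow> \<phi> i g \<in> carrier Aut_full_shift"
  using hom_\<phi> by (rule hom_in_carrier)

lemma rho_Aut:
  assumes "i \<in> V" "g \<in> carrier (G i)"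
  shows "rho i g \<in> carrier Aut_full_shift"
  unfolding rho_def
  using assms by (intro belt_Aut fin reads_Out nc_irrefl \<phi>_Aut)

lemma rho_mult:
  assumes "i \<in> V" "g \<in> carrier (G i)" "h \<in> carrier (G i)"
  shows "rho i (g \<otimes>\<^bsub>G i\<^esub> h) = rho i g \<circ> rho i h"
proof -
  have "\<phi> i (g \<otimes>\<^bsub>G i\<^esub> h) = \<phi> i g \<circ> \<phi> i h"
    using hom_mult [OF hom_\<phi> [OF assms(1)] assms(2,3)] by (simp add: Aut_simps)
  then show ?thesis
    using belt_comp [OF reads_Out [OF assms(1,1) nc_irrefl] \<phi>_Aut [OF assms(1,3)]]
    by (intro ext) (simp add: rho_def)
qed

lemma \<phi>_one: "i \<in> V \<Longrightarrow> \<phi> i \<one>\<^bsub>G i\<^esub> = id"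
  using group_hom.hom_one [of "G i" Aut_full_shift "\<phi> i"] group_G hom_\<phi> group_Aut_full_shift
  by (auto simp: group_hom_def group_hom_axioms_def Aut_simps)

lemma rho_one: "i \<in> V \<Longrightarrow> rho i \<one>\<^bsub>G i\<^esub> = id"
  by (auto simp: rho_def \<phi>_one belt_id fun_eq_iff)

lemma \<phi>_nontrivial:
  assumes "i \<in> V" "g \<in> carrier (G i)" "g \<noteq> \<one>\<^bsub>G i\<^esub>"
  shows "\<phi> i g \<noteq> id"
proof -
  interpret group "G i" using assms(1) by (rule group_G)
  show ?thesis using inj_onD [OF inj_\<phi> [OF assms(1)], of g "\<one>\<^bsub>G i\<^esub>"] \<phi>_one assms by auto
qed

lemma rho_commute:
  assumes "i \<in> V" "j \<in> V" "i \<noteq> j" "\<not> nc i j"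
  shows "rho i g \<circ> rho j h = rho j h \<circ> rho i g"
proof -
  have "\<not> nc j i" using assms(4) nc_sym by blast
  then show ?thesis
    using belt_commute [OF C_disjoint [OF assms(1-3)] reads_Out [OF assms(1,2,4)] reads_Out [OF assms(2,1)]]
    by (auto simp: rho_def fun_eq_iff)
qed

lemma cell_rho: "cell (rho i g x) p n s \<longleftrightarrow> cell x p n s"
  unfolding rho_def by (rule cell_modified [OF modified_belt])

lemma cell_ev: "cell (ev w x) p n s \<longleftrightarrow> cell x p n s"
  by (induction w) (simp_all add: cell_rho)

lemma tail_ev:
  assumes "tail x r t" "cell x (r + int t + int n + 14) n s"
  shows "tail (ev w x) r t"
proof (induction w)
  case (Cons p w)
  then show ?case
    using tail_modified [OF modified_belt [of "C (fst p)" "Out (fst p)" "ev w x" "\<phi> (fst p) (snd p)"], of r t n s]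
      assms(2) by (simp add: cell_ev rho_def)
qed (use assms in simp)

lemma cont_rho_other:
  assumes "i \<in> V" "j \<in> V" "i \<noteq> j" "n \<in> C i" "cell x p n s"
  shows "cont (rho j h x) (p, b) = cont x (p, b)"
  unfolding rho_def
  by (rule cont_modified [OF modified_belt C_disjoint [OF assms(1-3)] assms(5,4)])

lemma cont_ev_other:
  assumes "i \<in> V" "n \<in> C i" "cell x p n s" "w \<in> fp_words V G" "i \<notin> fst ` set w"
  shows "cont (ev w x) (p, b) = cont x (p, b)"
  using assms(4,5)
proof (induction w)
  case (Cons q w)
  then show ?case
    using cont_rho_other [of i "fst q" n "ev w x" p s "snd q" b] assms(1-3)
    by (cases q) (auto simp: cell_ev fp_words_Cons)
qed simp

lemma ev_off_payload:
  assumes "\<And>p n s. cell x p n s \<Longrightarrow> r \<noteq> p \<and> r \<noteq> p - 2"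
  shows "ev w x r = x r"
proof (induction w)
  case (Cons q w)
  have "rho (fst q) (snd q) (ev w x) r = ev w x r"
    unfolding rho_def
  proof (rule belt_off)
    fix p assume "p \<in> act (C (fst q)) (Out (fst q)) (ev w x)"
    then obtain n s where "cell (ev w x) p n s" by (rule actE)
    then show "r \<noteq> p \<and> r \<noteq> p - 2" using assms by (simp add: cell_ev)
  qed
  then show ?case using Cons by simp
qed simp

text \<open>\<open>val v\<close> is the symbol at position \<open>r\<close> after the suffix \<open>v\<close> of the word has acted. In \<open>carries\<close> a chain of
  vertex \<open>i\<close> follows and reads that symbol; in \<open>emits\<close> the symbol is itself in the last cell of a chain of
  vertex \<open>i\<close>, which must therefore not be continued to the right.\<close>

definition carries :: "'v \<Rightarrow> ('v \<times> 'g) list \<Rightarrow> (int \<Rightarrow> 'a) \<Rightarrow> int \<Rightarrow> nat \<Rightarrow> (('v \<times> 'g) list \<Rightarrow> 'a) \<Rightarrow> bool" where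
  "carries i w X r t val \<longleftrightarrow> tail X r t \<and>
     (\<forall>Y n s. (\<forall>k<r + int t + 7. Y k = X k) \<longrightarrow> n \<in> C i \<longrightarrow> cell Y (r + int t + int n + 14) n s \<longrightarrow>
       (\<forall>u v. w = u @ v \<longrightarrow> ev v Y r = val v))"

definition emits :: "'v \<Rightarrow> ('v \<times> 'g) list \<Rightarrow> (int \<Rightarrow> 'a) \<Rightarrow> int \<Rightarrow> nat \<Rightarrow> (('v \<times> 'g) list \<Rightarrow> 'a) \<Rightarrow> bool" where
  "emits i w X r t val \<longleftrightarrow> (\<exists>n\<in>C i. cell X r n t) \<and>
     (\<forall>Y. (\<forall>k<r + int t + 7. Y k = X k) \<longrightarrow> (\<forall>n\<in>C i. \<forall>s. \<not> cell Y (r + int t + int n + 14) n s) \<longrightarrow>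
       (\<forall>u v. w = u @ v \<longrightarrow> ev v Y r = val v))"

text \<open>A model of how the contents of the new chain evolve. The state of the conditional cell
  is taken from \<open>val w\<close>, the symbol it sees when the letter before \<open>w\<close>
  acts; so two configurations can be compared through their functions \<open>val\<close>
  alone.\<close>

primrec zrun :: "'v \<Rightarrow> int \<Rightarrow> int \<Rightarrow> nat \<Rightarrow> 'a \<Rightarrow> (('v \<times> 'g) list \<Rightarrow> 'a) \<Rightarrow> (int \<times> bool \<Rightarrow> 'a)
    \<Rightarrow> ('v \<times> 'g) list \<Rightarrow> int \<times> bool \<Rightarrow> 'a" where
  "zrun i d P N \<beta> val c [] = c"
| "zrun i d P N \<beta> val c (p # w) =
     (if fst p = i
      then let M = (if val w = \<beta> then Suc N else N)
        in upd (chain_rel d P M) (chain_set d P M) (\<phi> i (snd p)) (zrun i d P N \<beta> val c w)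
      else zrun i d P N \<beta> val c w)"

text \<open>Each letter of \<open>i\<close> is undone by the inverse automorphism on the chain of
  the same length. Contents can therefore be prescribed for the time after \<open>w\<close>.\<close>

lemma zrun_surj:
  assumes "d > 0" "w \<in> fp_words V G"
  shows "\<exists>c0. zrun i d P N \<beta> val c0 w = c"
  using assms(2)
proof (induction w arbitrary: c)
  case (Cons p w)
  have w: "w \<in> fp_words V G" using Cons.prems by (cases p) (simp add: fp_words_Cons)
  show ?case
  proof (cases "fst p = i")
    case True
    interpret group "Aut_full_shift :: ((int \<Rightarrow> 'a) \<Rightarrow> int \<Rightarrow> 'a) monoid"
      by (rule group_Aut_full_shift)
    have "\<phi> i (snd p) \<in> carrier Aut_full_shift"
      using True Cons.prems by (cases p) (auto simp: fp_words_Cons \<phi>_Aut)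
    then obtain h where h: "h \<in> carrier Aut_full_shift" "\<phi> i (snd p) \<circ> h = id"
      using inv_closed r_inv unfolding Aut_simps by blast
    define M where "M = (if val w = \<beta> then Suc N else N)"
    obtain c0 where "zrun i d P N \<beta> val c0 w = upd (chain_rel d P M) (chain_set d P M) h c"
      using Cons.IH [OF w] by blast
    then have "zrun i d P N \<beta> val c0 (p # w) = c"
      using True h(2) by (simp flip: M_def add: Let_def upd_upd [OF partial_inj_chain [OF assms(1)] chain_rel_subset h(1)] upd_id)
    then show ?thesis by blast
  next
    case False
    then show ?thesis using Cons.IH [OF w] by simp
  qed
qed simp

text \<open>The model consults \<open>val\<close> only when a letter of \<open>i\<close> acts, that
  is at suffixes directly following such a letter.\<close>

lemma zrun_cong:
  assumes "\<And>u f v. w = u @ (i, f) # v \<Longrightarrow> val v = val' v" "w = u @ v"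
  shows "zrun i d P N \<beta> val c v = zrun i d P N \<beta> val' c v"
  using assms(2)
proof (induction v arbitrary: u)
  case (Cons p v)
  have "zrun i d P N \<beta> val c v = zrun i d P N \<beta> val' c v"
    using Cons.IH [of "u @ [p]"] Cons.prems by simp
  moreover have "val v = val' v" if "fst p = i"
    using assms(1) [of u "snd p" v] Cons.prems that by (cases p) auto
  ultimately show ?case by (simp add: Let_def)
qed simp

text \<open>Letters of other vertices leave the cells of \<open>i\<close> alone, and letters of
  \<open>i\<close> follow \<open>belt_zone\<close>, so the zone obeys the model \<open>zrun\<close>.
  The last conclusion treats one further letter of \<open>i\<close>, which is needed for
  \<open>g\<close> since it is not part of \<open>w\<close>.\<close>

lemma zone_invariant:
  assumes i: "i \<in> V" and n: "n0 \<in> C i" "cond n0 = Some (t, \<beta>)" "n1 \<in> C i" "cond n1 = None"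
    and s: "s \<in> Out i" and d: "d = int s + int n1 + 14" and P: "P = r + int t + int n0 + 14 + int N * d"
    and car: "carries i w' X0 r t val" and w: "w = u @ v" "w' = w" "w \<in> fp_words V G"
    and Y: "\<And>k. k < r + int t + 7 \<Longrightarrow> Y k = X0 k"
    and cells: "\<And>k. k < N \<Longrightarrow> cell Y (P - int k * d) n1 s" "cell Y (P - int N * d) n0 s"
    and right: "\<And>m t. m \<in> C i \<Longrightarrow> \<not> cell Y (P + int s + int m + 14) m t"
    and c: "\<And>k b. k \<le> N \<Longrightarrow> cont Y (P - int k * d, b) = c (P - int k * d, b)"
  shows "\<forall>k\<le>N. \<forall>b. cont (ev v Y) (P - int k * d, b) = zrun i d P N \<beta> val c v (P - int k * d, b)"
    and "ev v Y r = val v"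
    and "\<And>k b f. k \<le> N \<Longrightarrow> cont (rho i f (ev v Y)) (P - int k * d, b) =
      (let M = (if val v = \<beta> then Suc N else N) in
       upd (chain_rel d P M) (chain_set d P M) (\<phi> i f) (zrun i d P N \<beta> val c v) (P - int k * d, b))"
proof -
  have PN: "P - int N * d = r + int t + int n0 + 14" by (simp add: P)
  have tY: "tail Y r t"
    using car Y by (auto simp: carries_def intro: tail_agree)
  have c0: "cell Y (r + int t + int n0 + 14) n0 s" using cells(2) PN by simp
  have val: "ev v Y r = val v" if "w = u @ v" for u v
    using car n(1) c0 Y that w(2) unfolding carries_def by blast
  \<comment> \<open>A cell of \<open>i\<close> ending directly before the zone would carry the tag
    \<open>t\<close> by \<open>tail_tail\<close>. But \<open>i\<close> reads \<open>t\<close>, and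
    no tag read by \<open>i\<close> lies in \<open>Out i\<close>.\<close>
  have left: "p + int u + int n0 + 14 \<noteq> P - int N * d"
    if "m \<in> C i" "u \<in> Out i" "cell (ev v Y) p m u" for p m u v
  proof
    assume e: "p + int u + int n0 + 14 = P - int N * d"
    have t: "tail (ev v Y) r t" "tail (ev v Y) p u"
      using tail_ev [OF tY c0] that(3) by (auto simp: cell_def)
    have "u = t"
    proof (cases "r \<le> p")
      case True
      then show ?thesis using tail_tail [OF t True] e PN by simp
    next
      case False
      then have "p \<le> r" by simp
      then show ?thesis using tail_tail [OF t(2,1)] e PN by simp
    qed
    moreover have "t \<in> reads (C i)" using n(1,2) by (auto simp: reads_def)
    ultimately show False using reads_Out [OF i i nc_irrefl] that(2) by blast
  qed
  have step: "cont (rho i f (ev v Y)) (P - int k * d, b) =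
      (let M = (if val v = \<beta> then Suc N else N) in
       upd (chain_rel d P M) (chain_set d P M) (\<phi> i f) (zrun i d P N \<beta> val c v) (P - int k * d, b))"
    if "\<forall>k\<le>N. \<forall>b. cont (ev v Y) (P - int k * d, b) = zrun i d P N \<beta> val c v (P - int k * d, b)"
      "w = u @ v" "k \<le> N" for u v k b f
  proof -
    have "enabled (ev v Y) (P - int N * d) n0 \<longleftrightarrow> val v = \<beta>"
      using tail_ev [OF tY c0, of v] val [OF that(2)] by (simp add: enabled_def n(2) PN)
    then show ?thesis
      unfolding rho_def Let_def
      by (intro belt_zone [OF n(1,3,4) s d]) (use cells right left that in \<open>auto simp: cell_ev\<close>)
  qed
  have main: "\<forall>k\<le>N. \<forall>b. cont (ev v Y) (P - int k * d, b) = zrun i d P N \<beta> val c v (P - int k * d, b)"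
    if "w = u @ v" for u v
    using that
  proof (induction v arbitrary: u)
    case Nil
    then show ?case using c by simp
  next
    case (Cons p v)
    have IH: "\<forall>k\<le>N. \<forall>b. cont (ev v Y) (P - int k * d, b) = zrun i d P N \<beta> val c v (P - int k * d, b)"
      by (rule Cons.IH [of "u @ [p]"]) (simp add: Cons.prems)
    have p: "fst p \<in> V" using w(3) unfolding Cons.prems by (cases p) (simp add: fp_words_append fp_words_Cons)
    show ?case
    proof (cases "fst p = i")
      case True
      then show ?thesis
        using step [OF IH, of "u @ [p]"] Cons.prems by (simp add: Let_def)
    next
      case False
      have "cont (ev (p # v) Y) (P - int k * d, b) = cont (ev v Y) (P - int k * d, b)" if "k \<le> N" for k b
      proof -
        have "\<exists>n\<in>C i. cell Y (P - int k * d) n s"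
        proof (cases "k = N")
          case True
          then show ?thesis using cells(2) n(1) by blast
        next
          case False
          then have "k < N" using that by simp
          then show ?thesis using cells(1) n(3) by blast
        qed
        then obtain n where "n \<in> C i" "cell Y (P - int k * d) n s" by blast
        then show ?thesis
          using cont_rho_other [OF i p, of n "ev v Y" "P - int k * d" s] False by (simp add: cell_ev)
      qed
      then show ?thesis using IH False by simp
    qed
  qed
  show "\<forall>k\<le>N. \<forall>b. cont (ev v Y) (P - int k * d, b) = zrun i d P N \<beta> val c v (P - int k * d, b)"
    by (rule main [OF w(1)])
  show "ev v Y r = val v" by (rule val [OF w(1)])
  show "cont (rho i f (ev v Y)) (P - int k * d, b) =
      (let M = (if val v = \<beta> then Suc N else N) in
       upd (chain_rel d P M) (chain_set d P M) (\<phi> i f) (zrun i d P N \<beta> val c v) (P - int k * d, b))"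
    if "k \<le> N" for k b f
    by (rule step [OF main [OF w(1)] w(1) that])
qed

text \<open>The first cell of the new chain is connected exactly when the symbol read is \<open>val1 w\<close>. Both
  configurations start with the same contents of the chain, chosen so that \<open>w\<close> turns them into a
  witness of \<open>chain_detects\<close>; then \<open>g\<close> meets a complete chain in the first configuration and one without its
  first cell in the second.\<close>

lemma extend_chain:
  assumes i: "i \<in> V" and g: "g \<in> carrier (G i)" "g \<noteq> \<one>\<^bsub>G i\<^esub>" and w: "w \<in> fp_words V G" and s: "s \<in> Out i"
    and t: "\<And>a. \<exists>n\<in>C i. cond n = Some (t, a)"
    and car: "carries i w X1 r t val1" "carries i w X2 r t val2"
    and same: "\<And>u f v. w = u @ (i, f) # v \<Longrightarrow> val1 v = val2 v" and diff: "val1 w \<noteq> val2 w"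
  shows "\<exists>X1 X2 r val1 val2. emits i ((i, g) # w) X1 r s val1 \<and> emits i ((i, g) # w) X2 r s val2 \<and>
    (\<forall>u v. (i, g) # w = u @ v \<longrightarrow> u \<noteq> [] \<longrightarrow> val1 v = val2 v) \<and> val1 ((i, g) # w) \<noteq> val2 ((i, g) # w)"
proof -
  define \<beta> where "\<beta> = val1 w"
  obtain n0 where n0: "n0 \<in> C i" "cond n0 = Some (t, \<beta>)" using t by blast
  obtain n1 where n1: "n1 \<in> C i" "cond n1 = None" using unconditional [OF i] by blast
  obtain N where N: "\<And>P d. d > 0 \<Longrightarrow> \<exists>c.
      upd (chain_rel d P (Suc N)) (chain_set d P (Suc N)) (\<phi> i g) c (P, True) \<noteq>
      upd (chain_rel d P N) (chain_set d P N) (\<phi> i g) c (P, True)"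
    using chain_detects [OF \<phi>_Aut [OF i g(1)] \<phi>_nontrivial [OF i g]] by blast
  define d where "d = int s + int n1 + 14"
  define q where "q = r + int t + int n0 + 14"
  define P where "P = q + int N * d"
  have d0: "d > 0" by (simp add: d_def)
  obtain c where c: "upd (chain_rel d P (Suc N)) (chain_set d P (Suc N)) (\<phi> i g) c (P, True) \<noteq>
      upd (chain_rel d P N) (chain_set d P N) (\<phi> i g) c (P, True)"
    using N [OF d0] by blast
  obtain c0 where c0: "zrun i d P N \<beta> val1 c0 w = c" using zrun_surj [OF d0 w] by blast
  \<comment> \<open>Although \<open>val1 w\<close> and \<open>val2 w\<close> differ, the contents
    after \<open>w\<close> agree: the value at \<open>w\<close> itself is consulted only when
    \<open>g\<close> acts.\<close>
  have eq: "zrun i d P N \<beta> val1 c0 v = zrun i d P N \<beta> val2 c0 v" if "w = u @ v" for u v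
    using zrun_cong [of w i val1 val2 u v] same that by blast
  define out where "out = (\<lambda>M. upd (chain_rel d P M) (chain_set d P M) (\<phi> i g) c (P, True))"
  \<comment> \<open>The symbol at \<open>P\<close> in both configurations: only after the whole word
    does it depend on the length \<open>M\<close> of the chain met by \<open>g\<close>.\<close>
  define V' where "V' = (\<lambda>M v. if v = (i, g) # w then out M else zrun i d P N \<beta> val1 c0 v (P, True))"
  have ex: "\<exists>X. emits i ((i, g) # w) X P s (V' (if val w = \<beta> then Suc N else N))"
    if X: "carries i w X0 r t val" and val: "\<And>u v. w = u @ v \<Longrightarrow> zrun i d P N \<beta> val c0 v = zrun i d P N \<beta> val1 c0 v"
    for X0 val
  proof -
    have "q = (r + int t + 7) + int n0 + 7" by (simp add: q_def)
    from build_zone [OF d_def this, of X0 N c0]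
    obtain X where X': "\<And>k. k < r + int t + 7 \<Longrightarrow> X k = X0 k" "cell X q n0 s"
      "\<And>k. k < N \<Longrightarrow> cell X (q + int (Suc k) * d) n1 s"
      "\<And>k b. k \<le> N \<Longrightarrow> cont X (q + int k * d, b) = c0 (q + int k * d, b)" by blast
    have Pk: "P - int k * d = q + int (N - k) * d" if "k \<le> N" for k
      using that by (simp add: P_def of_nat_diff algebra_simps)
    have Xc: "cell X (P - int k * d) n1 s" if "k < N" for k
      using X'(3) [of "N - Suc k"] that by (simp add: Pk Suc_diff_Suc del: of_nat_Suc)
    have XN: "cell X (P - int N * d) n0 s" using X'(2) by (simp add: P_def)
    have le: "P - int k * d \<le> P" for k using d0 by simp
    have ge: "r + int t + 7 \<le> P + int s + 7" using d0 by (simp add: P_def q_def)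
    have "\<exists>n\<in>C i. cell X P n s"
      using Xc [of 0] XN n0(1) n1(1) by (cases "N = 0") auto
    moreover have "ev v Y P = V' (if val w = \<beta> then Suc N else N) v"
      if Y: "\<forall>k<P + int s + 7. Y k = X k" and free: "\<forall>n\<in>C i. \<forall>u. \<not> cell Y (P + int s + int n + 14) n u"
        and split: "(i, g) # w = u @ v" for Y u v
    proof -
      have cY: "cell Y (P - int k * d) n s" if "cell X (P - int k * d) n s" for k n
        by (rule cell_agree [OF that]) (use Y le [of k] in auto)
      have cont: "cont Y (P - int k * d, b) = c0 (P - int k * d, b)" if "k \<le> N" for k b
      proof -
        have "cont Y (P - int k * d, b) = cont X (P - int k * d, b)"
          unfolding cont_def using le [of k] Y by auto
        then show ?thesis using X'(4) [of "N - k" b] Pk [OF that] by simp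
      qed
      have Y0: "Y k = X0 k" if "k < r + int t + 7" for k
        using that X'(1) Y ge by simp
      note Z = zone_invariant [OF i n0 n1 s d_def _ X _ refl w Y0 cY [OF Xc] cY [OF XN] _ cont]
      have PE: "P = r + int t + int n0 + 14 + int N * d" by (simp add: P_def q_def)
      have fr: "\<not> cell Y (P + int s + int m + 14) m u" if "m \<in> C i" for m u using free that by blast
      show ?thesis
      proof (cases u)
        case Nil
        then have v: "v = (i, g) # w" using split by simp
        have "cont (rho i g (ev w Y)) (P - int 0 * d, True) =
          (let M = (if val w = \<beta> then Suc N else N) in
           upd (chain_rel d P M) (chain_set d P M) (\<phi> i g) (zrun i d P N \<beta> val c0 w) (P - int 0 * d, True))"
          by (rule Z(3) [OF PE, of "[]"]) (use fr in auto)
        moreover have "zrun i d P N \<beta> val c0 w = c" using val [of "[]" w] c0 by simp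
        ultimately show ?thesis by (simp add: v V'_def out_def cont_def Let_def)
      next
        case (Cons p u')
        then have wv: "w = u' @ v" using split by simp
        then have "length v \<le> length w" by simp
        then have "v \<noteq> (i, g) # w" by auto
        moreover have "\<forall>k\<le>N. \<forall>b. cont (ev v Y) (P - int k * d, b) = zrun i d P N \<beta> val c0 v (P - int k * d, b)"
          by (rule Z(1) [OF PE wv]) (use fr in auto)
        then have "cont (ev v Y) (P - int 0 * d, True) = zrun i d P N \<beta> val c0 v (P - int 0 * d, True)"
          by blast
        ultimately show ?thesis using val [OF wv] by (simp add: V'_def cont_def)
      qed
    qed
    ultimately show ?thesis unfolding emits_def by blast
  qed
  obtain Z1 where Z1: "emits i ((i, g) # w) Z1 P s (V' (Suc N))"
    using ex [OF car(1)] by (auto simp: \<beta>_def)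
  obtain Z2 where Z2: "emits i ((i, g) # w) Z2 P s (V' N)"
    using ex [OF car(2)] eq diff by (auto simp: \<beta>_def)
  have "V' (Suc N) v = V' N v" if "(i, g) # w = u @ v" "u \<noteq> []" for u v
    using that by (cases u) (auto simp: V'_def)
  moreover have "V' (Suc N) ((i, g) # w) \<noteq> V' N ((i, g) # w)"
    using c by (simp add: V'_def out_def)
  ultimately show ?thesis using Z1 Z2 by blast
qed

text \<open>A bare tail without a head imitates the end of a cell. With zeros to its left, the
  position \<open>0\<close> is not a payload position of any cell, so no word changes it, whatever
  is appended on the right.\<close>

lemma initial_signal:
  assumes i: "i \<in> V" and w: "i \<notin> fst ` set w"
  shows "\<exists>X. carries i w X 0 t (\<lambda>_. a)"
proof -
  define X where "X = (\<lambda>k. if k = 0 then a else if k = 3 \<or> k = int t + 5 then a1 else a0)"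
  have "tail X 0 t" by (auto simp: tail_def X_def)
  moreover have "ev v Y 0 = a" if Y: "\<forall>k<0 + int t + 7. Y k = X k" for Y v
  proof -
    have "ev v Y 0 = Y 0"
    proof (rule ev_off_payload)
      fix p n s assume c: "cell Y p n s"
      have "p \<noteq> 0"
      proof
        assume "p = 0"
        then have "Y (- 4) = a1" using c by (simp add: cell_def head_def)
        moreover have "Y (- 4) = a0" using Y by (simp add: X_def)
        ultimately show False using a0_a1 by simp
      qed
      moreover have "p \<noteq> 2"
      proof
        assume "p = 2"
        then have "Y (- 2) = a1" using c by (simp add: cell_def head_def)
        moreover have "Y (- 2) = a0" using Y by (simp add: X_def)
        ultimately show False using a0_a1 by simp
      qed
      ultimately show "0 \<noteq> p \<and> 0 \<noteq> p - 2" by simp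
    qed
    also have "\<dots> = a" using Y by (simp add: X_def)
    finally show ?thesis .
  qed
  ultimately show ?thesis unfolding carries_def by blast
qed

text \<open>The symbol follows \<open>val\<close> while the letters of \<open>z\<close> act.
  Afterwards it stays constant, since \<open>m\<close> contains no letter of its owner
  \<open>j\<close>. The length test tells suffixes of \<open>z\<close> from longer suffixes of
  \<open>m @ z\<close>.\<close>

lemma relay_signal:
  assumes i: "i \<in> V" "j \<in> V" "i \<noteq> j" and m: "m \<in> fp_words V G" "j \<notin> fst ` set m"
    and e: "emits j z X r t val"
  shows "carries i (m @ z) X r t (\<lambda>v. if length v \<le> length z then val v else val z)"
proof -
  obtain n where n: "n \<in> C j" "cell X r n t" using e unfolding emits_def by blast
  have "ev v Y r = (if length v \<le> length z then val v else val z)"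
    if Y: "\<forall>k<r + int t + 7. Y k = X k" and q: "q \<in> C i" "cell Y (r + int t + int q + 14) q s"
      and uv: "m @ z = u @ v" for Y q s u v
  proof -
    \<comment> \<open>The place directly to the right is taken by a cell of \<open>i\<close>, whose
      code does not belong to \<open>j\<close>; hence the chain of \<open>j\<close> ends
      here.\<close>
    have "\<not> cell Y (r + int t + int l + 14) l s'" if "l \<in> C j" for l s'
    proof
      assume "cell Y (r + int t + int l + 14) l s'"
      then have "l = q" using cell_unique [OF _ q(2)] by simp
      then show False using that q(1) C_disjoint [OF i] by blast
    qed
    then have val: "ev v Y r = val v" if "z = u @ v" for u v
      using e Y that unfolding emits_def by blast
    from uv consider us where "u = m @ us" "z = us @ v" | us where "m = u @ us" "v = us @ z"
      by (auto simp: append_eq_append_conv2)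
    then show ?thesis
    proof cases
      case 1
      then show ?thesis using val [OF 1(2)] by simp
    next
      case 2
      have "cell Y r n t"
        by (rule cell_agree [OF n(2)]) (use Y in auto)
      then have "cell (ev z Y) r n t" by (simp add: cell_ev)
      then have "cont (ev us (ev z Y)) (r, True) = cont (ev z Y) (r, True)"
        using cont_ev_other [OF i(2) n(1)] m 2(1) by (auto simp: fp_words_append image_Un)
      then have "ev v Y r = val z"
        using val [of "[]" z] by (simp add: 2(2) ev_append cont_def)
      then show ?thesis using 2(2) by (cases us) auto
    qed
  qed
  moreover have "tail X r t" using n(2) by (simp add: cell_def)
  ultimately show ?thesis unfolding carries_def by blast
qed

lemma reduced_suffix:
  assumes "reduced_word nc G (u @ w)"
  shows "reduced_word nc G w"
  unfolding reduced_word_def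
proof (intro conjI allI impI)
  show "\<forall>p\<in>set w. snd p \<noteq> \<one>\<^bsub>G (fst p)\<^esub>" using assms by (simp add: reduced_word_def)
  fix u' i g m h v assume "w = u' @ (i, g) # m @ (i, h) # v"
  then have "u @ w = (u @ u') @ (i, g) # m @ (i, h) # v" by simp
  then show "\<exists>p\<in>set m. nc i (fst p)" using assms unfolding reduced_word_def by blast
qed

text \<open>The tag \<open>s\<close> is arbitrary because the reader of the emitted symbol dictates
  it: in the induction step, \<open>i\<close> selects a tag of \<open>j\<close> on which it has
  conditions.\<close>

lemma reduced_emits:
  assumes "w \<in> fp_words V G" "reduced_word nc G w" "w = (i, g) # w'" "s \<in> Out i"
  shows "\<exists>X1 X2 r val1 val2. emits i w X1 r s val1 \<and> emits i w X2 r s val2 \<and>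
    (\<forall>u v. w = u @ v \<longrightarrow> u \<noteq> [] \<longrightarrow> val1 v = val2 v) \<and> val1 w \<noteq> val2 w"
  using assms
proof (induction "length w" arbitrary: w i g w' s rule: less_induct)
  case less
  have i: "i \<in> V" and g: "g \<in> carrier (G i)" and w': "w' \<in> fp_words V G"
    using less.prems(1,3) by (simp_all add: fp_words_Cons)
  have g1: "g \<noteq> \<one>\<^bsub>G i\<^esub>" using less.prems(2,3) by (auto simp: reduced_word_def)
  show ?case
  proof (cases "i \<in> fst ` set w'")
    case False
    obtain t where t: "\<And>a. \<exists>n\<in>C i. cond n = Some (t, a)" using own_channel [OF i] by blast
    obtain X1 where X1: "carries i w' X1 0 t (\<lambda>_. a0)" using initial_signal [OF i False] by blast
    obtain X2 where X2: "carries i w' X2 0 t (\<lambda>_. a1)" using initial_signal [OF i False] by blast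
    show ?thesis
      unfolding less.prems(3)
      by (rule extend_chain [OF i g g1 w' less.prems(4) t X1 X2]) (use False a0_a1 in force)+
  next
    case True
    then obtain x h y where "w' = x @ (i, h) # y" by (force dest: split_list)
    then have "w = [] @ (i, g) # x @ (i, h) # y" by (simp add: less.prems(3))
    then have "\<exists>p\<in>set x. nc i (fst p)" using less.prems(2) unfolding reduced_word_def by blast
    then have "\<exists>p\<in>set w'. nc i (fst p)" using \<open>w' = x @ (i, h) # y\<close> by auto
    then obtain m p z where split: "w' = m @ p # z" "nc i (fst p)" "\<forall>q\<in>set m. \<not> nc i (fst q)"
      using split_list_first_prop [of w' "\<lambda>p. nc i (fst p)"] by blast
    obtain j h where p: "p = (j, h)" by (cases p)
    have j: "j \<in> V" and m: "m \<in> fp_words V G" and z: "(j, h) # z \<in> fp_words V G"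
      using w' by (auto simp: split(1) p fp_words_append fp_words_Cons)
    have ij: "i \<noteq> j" "nc i j" using split(2) nc_irrefl by (auto simp: p)
    have jm: "j \<notin> fst ` set m" using split(3) ij(2) by auto
    \<comment> \<open>Reducedness would put a letter not adjacent to \<open>i\<close> before such an
      occurrence, earlier than the first one \<open>p\<close>.\<close>
    have im: "i \<notin> fst ` set m"
    proof
      assume "i \<in> fst ` set m"
      then obtain a f b where ab: "m = a @ (i, f) # b" by (force dest: split_list)
      then have "w = [] @ (i, g) # a @ (i, f) # (b @ p # z)" by (simp add: less.prems(3) split(1))
      then have "\<exists>q\<in>set a. nc i (fst q)" using less.prems(2) unfolding reduced_word_def by blast
      then show False using split(3) ab by auto
    qed
    obtain t where t: "t \<in> Out j" "\<And>a. \<exists>n\<in>C i. cond n = Some (t, a)"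
      using channel [OF i j ij(2)] by blast
    have "reduced_word nc G ((j, h) # z)"
      by (rule reduced_suffix [of "(i, g) # m"]) (use less.prems(2,3) split(1) p in simp)
    moreover have "length ((j, h) # z) < length w" by (simp add: less.prems(3) split(1))
    ultimately obtain X1 X2 r val1 val2 where X: "emits j ((j, h) # z) X1 r t val1"
      "emits j ((j, h) # z) X2 r t val2" "\<And>u v. (j, h) # z = u @ v \<Longrightarrow> u \<noteq> [] \<Longrightarrow> val1 v = val2 v"
      "val1 ((j, h) # z) \<noteq> val2 ((j, h) # z)"
      using less.hyps [OF _ z _ refl t(1)] by blast
    note c = relay_signal [OF i j ij(1) m jm X(1)] relay_signal [OF i j ij(1) m jm X(2)]
    show ?thesis
      unfolding less.prems(3) split(1) p
    proof (rule extend_chain [OF i g g1 _ less.prems(4) t(2) c])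
      show "m @ (j, h) # z \<in> fp_words V G" using w' by (simp add: split(1) p)
      fix u f v assume "m @ (j, h) # z = u @ (i, f) # v"
      then consider us where "u = m @ us" "(j, h) # z = us @ (i, f) # v"
        | us where "m = u @ us" "(i, f) # v = us @ (j, h) # z"
        by (auto simp: append_eq_append_conv2)
      \<comment> \<open>Neither \<open>m\<close> nor \<open>(j, h)\<close> supplies a letter of
        \<open>i\<close>, so the suffix after such a letter is proper in \<open>(j, h) # z\<close>,
        where the induction hypothesis makes the two values equal.\<close>
      then have "\<exists>us. (j, h) # z = (us @ [(i, f)]) @ v"
      proof cases
        case 1
        then show ?thesis by (intro exI [of _ us]) simp
      next
        case 2
        then show ?thesis using im ij(1) by (cases us) auto
      qed
      then obtain us where us: "(j, h) # z = (us @ [(i, f)]) @ v" by blast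
      then have "length ((j, h) # z) = length us + 1 + length v" by simp
      then have "length v \<le> length ((j, h) # z)" by simp
      then show "(if length v \<le> length ((j, h) # z) then val1 v else val1 ((j, h) # z)) =
          (if length v \<le> length ((j, h) # z) then val2 v else val2 ((j, h) # z))"
        using X(3) [OF us] by simp
    qed (use X(4) in auto)
  qed
qed

text \<open>If \<open>w\<close> acted trivially, then \<open>val [] = val w\<close> in both
  configurations. The values at the proper suffix \<open>[]\<close> agree, while those at
  \<open>w\<close> differ.\<close>

theorem reduced_nontrivial:
  assumes "w \<in> fp_words V G" "reduced_word nc G w" "w \<noteq> []"
  shows "ev w \<noteq> id"
proof
  assume id: "ev w = id"
  obtain i g w' where w: "w = (i, g) # w'" using assms(3) by (cases w) auto
  have i: "i \<in> V" using assms(1) by (simp add: w fp_words_Cons)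
  obtain s where s: "s \<in> Out i" using Out_nonempty [OF i] by blast
  obtain X1 X2 r val1 val2 where e: "emits i w X1 r s val1" "emits i w X2 r s val2"
    "\<And>u v. w = u @ v \<Longrightarrow> u \<noteq> [] \<Longrightarrow> val1 v = val2 v" "val1 w \<noteq> val2 w"
    using reduced_emits [OF assms(1,2) w s] by blast
  have *: "val [] = val w" if "emits i w X r s val" for X val
  proof -
    \<comment> \<open>Filling up with \<open>a0\<close> leaves no cell to the right, as
      \<open>emits\<close> requires.\<close>
    define Y where "Y = (\<lambda>k. if k < r + int s + 7 then X k else a0)"
    have "\<not> cell Y (r + int s + int n + 14) n t" for n t
      using a0_a1 by (auto simp: cell_def head_def Y_def)
    then have "ev v Y r = val v" if "w = u @ v" for u v
      using \<open>emits i w X r s val\<close> that unfolding emits_def by (auto simp: Y_def)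
    from this [of w "[]"] this [of "[]" w] show ?thesis using id by simp
  qed
  show False
    using * [OF e(1)] * [OF e(2)] e(3) [of w "[]"] e(4) assms(3) by simp
qed

end

section \<open>Words in the graph product\<close>

locale group_family =
  fixes V :: "'v set" and E :: "'v set set" and G :: "'v \<Rightarrow> ('g, 'm) monoid_scheme"
  assumes group_G: "i \<in> V \<Longrightarrow> group (G i)"
begin

abbreviation "F \<equiv> free_product V G"
abbreviation "N \<equiv> normal_closure F (graph_commutators V E G)"
abbreviation "P \<equiv> graph_product V E G"

definition fcls :: "('v \<times> 'g) list \<Rightarrow> ('v \<times> 'g) list set" where
  "fcls w = fp_rel V G `` {w}"

definition gcls :: "('v \<times> 'g) list \<Rightarrow> ('v \<times> 'g) list set set" where
  "gcls w = N #>\<^bsub>F\<^esub> fcls w"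

lemma group_F: "group F"
  by (rule group_free_product [OF group_G])

lemma normal_N: "N \<lhd> F"
  by (intro normal_normal_closure group_F graph_commutators_subset group_G)

lemma carrier_F: "carrier F = fcls ` fp_words V G"
  by (auto simp: free_product_def quotient_def fcls_def)

lemma fcls_closed: "w \<in> fp_words V G \<Longrightarrow> fcls w \<in> carrier F"
  by (simp add: carrier_F)

lemma fcls_append: "u \<in> fp_words V G \<Longrightarrow> w \<in> fp_words V G \<Longrightarrow> fcls (u @ w) = fcls u \<otimes>\<^bsub>F\<^esub> fcls w"
  unfolding fcls_def by (simp add: free_product_mult_class [OF group_G])

lemma fcls_eq: "(u, w) \<in> fp_rel V G \<Longrightarrow> fcls u = fcls w"
  unfolding fcls_def by (rule equiv_class_eq [OF equiv_fp_rel [OF group_G]])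

lemma fcls_eqD: "fcls u = fcls w \<Longrightarrow> w \<in> fp_words V G \<Longrightarrow> (u, w) \<in> fp_rel V G"
  unfolding fcls_def by (rule eq_equiv_class [OF _ equiv_fp_rel [OF group_G]])

lemma carrier_P: "carrier P = gcls ` fp_words V G"
  by (auto simp: graph_product_def FactGroup_def RCOSETS_def carrier_F gcls_def)

lemma gcls_append:
  assumes "u \<in> fp_words V G" "w \<in> fp_words V G"
  shows "gcls (u @ w) = gcls u \<otimes>\<^bsub>P\<^esub> gcls w"
  using normal.rcos_sum [OF normal_N fcls_closed [OF assms(1)] fcls_closed [OF assms(2)]]
  by (simp add: graph_product_def FactGroup_def gcls_def fcls_append assms)

lemma gcls_eq: "(u, w) \<in> fp_rel V G \<Longrightarrow> gcls u = gcls w"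
  by (simp add: gcls_def fcls_eq)

lemma gcls_context:
  assumes "u \<in> fp_words V G" "w \<in> fp_words V G" "x \<in> fp_words V G" "y \<in> fp_words V G" "gcls x = gcls y"
  shows "gcls (u @ x @ w) = gcls (u @ y @ w)"
  using assms by (simp add: gcls_append fp_words_append)

lemma gcls_commute:
  assumes "i \<in> V" "j \<in> V" "{i, j} \<in> E" "a \<in> carrier (G i)" "b \<in> carrier (G j)"
  shows "gcls [(i, a), (j, b)] = gcls [(j, b), (i, a)]"
proof -
  interpret F: group F by (rule group_F)
  interpret N: normal N F by (rule normal_N)
  have w: "[(i, a)] \<in> fp_words V G" "[(j, b)] \<in> fp_words V G"
    using assms by (simp_all add: fp_words_Cons fp_words_Nil)
  define x where "x = fcls [(i, a)]"
  define y where "y = fcls [(j, b)]"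
  have xy: "x \<in> carrier F" "y \<in> carrier F" using w by (simp_all add: x_def y_def fcls_closed)
  define k where "k = x \<otimes>\<^bsub>F\<^esub> y \<otimes>\<^bsub>F\<^esub> inv\<^bsub>F\<^esub> x \<otimes>\<^bsub>F\<^esub> inv\<^bsub>F\<^esub> y"
  have "k \<in> graph_commutators V E G"
    unfolding graph_commutators_def Let_def mem_Collect_eq k_def x_def y_def fp_inj_def fcls_def
    using assms by blast
  then have k: "k \<in> N" unfolding normal_closure_def by blast
  have "x \<otimes>\<^bsub>F\<^esub> y = k \<otimes>\<^bsub>F\<^esub> (y \<otimes>\<^bsub>F\<^esub> x)"
    using xy by (simp add: k_def F.m_assoc F.inv_solve_left F.inv_solve_left')
  then have "N #>\<^bsub>F\<^esub> (x \<otimes>\<^bsub>F\<^esub> y) = N #>\<^bsub>F\<^esub> k #>\<^bsub>F\<^esub> (y \<otimes>\<^bsub>F\<^esub> x)"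
    using F.coset_mult_assoc [OF N.subset, of k "y \<otimes>\<^bsub>F\<^esub> x"] xy N.mem_carrier [OF k] by simp
  also have "\<dots> = N #>\<^bsub>F\<^esub> (y \<otimes>\<^bsub>F\<^esub> x)"
    using N.rcos_const [OF F.is_group k] by simp
  finally show ?thesis
    using fcls_append [OF w] fcls_append [OF w(2,1)] by (simp add: gcls_def x_def y_def)
qed

lemma gcls_move:
  assumes "i \<in> V" "g \<in> carrier (G i)" "m \<in> fp_words V G" "\<And>p. p \<in> set m \<Longrightarrow> {i, fst p} \<in> E"
  shows "gcls (m @ [(i, g)]) = gcls ((i, g) # m)"
  using assms(3,4)
proof (induction m)
  case (Cons p m)
  obtain j h where p: "p = (j, h)" by (cases p)
  have j: "j \<in> V" "h \<in> carrier (G j)" and m: "m \<in> fp_words V G"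
    using Cons.prems(1) by (simp_all add: p fp_words_Cons)
  have ig: "[(i, g)] \<in> fp_words V G" using assms(1,2) by (simp add: fp_words_Cons fp_words_Nil)
  have "{i, j} \<in> E" using Cons.prems(2) [of p] by (simp add: p)
  have IH: "gcls (m @ [(i, g)]) = gcls ((i, g) # m)" by (rule Cons.IH [OF m Cons.prems(2)]) simp
  have "gcls ([p] @ (m @ [(i, g)]) @ []) = gcls ([p] @ ((i, g) # m) @ [])"
    by (rule gcls_context [OF _ fp_words_Nil _ _ IH])
       (use j m ig p in \<open>simp_all add: fp_words_append fp_words_Cons fp_words_Nil\<close>)
  also have "[p] @ ((i, g) # m) @ [] = [] @ [(j, h), (i, g)] @ m" by (simp add: p)
  also have "gcls \<dots> = gcls ([] @ [(i, g), (j, h)] @ m)"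
    by (rule gcls_context [OF fp_words_Nil m])
       (use j assms(1,2) gcls_commute [OF assms(1) j(1) \<open>{i, j} \<in> E\<close> assms(2) j(2)]
        in \<open>simp_all add: fp_words_Cons fp_words_Nil\<close>)
  finally show ?case by (simp add: p)
qed simp

abbreviation "nonadjacent i j \<equiv> i \<noteq> j \<and> {i, j} \<notin> E"

lemma shorten:
  assumes "w \<in> fp_words V G" "\<not> reduced_word nonadjacent G w"
  shows "\<exists>w'\<in>fp_words V G. length w' < length w \<and> gcls w' = gcls w"
proof -
  from assms(2) consider p where "p \<in> set w" "snd p = \<one>\<^bsub>G (fst p)\<^esub>"
    | u i g m h v where "w = u @ (i, g) # m @ (i, h) # v" "\<forall>p\<in>set m. i = fst p \<or> {i, fst p} \<in> E"
    unfolding reduced_word_def by blast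
  then show ?thesis
  proof cases
    case 1
    obtain u v where w: "w = u @ p # v" using split_list [OF 1(1)] by blast
    obtain i g where p: "p = (i, g)" by (cases p)
    have uv: "u \<in> fp_words V G" "v \<in> fp_words V G" "i \<in> V"
      using assms(1) by (auto simp: w p fp_words_append fp_words_Cons)
    have "(u @ [(i, \<one>\<^bsub>G i\<^esub>)] @ v, u @ v) \<in> fp_rel V G" by (rule fp_one [OF uv])
    then have "gcls w = gcls (u @ v)" using gcls_eq 1(2) by (simp add: w p)
    then show ?thesis using uv by (intro bexI [of _ "u @ v"]) (auto simp: w fp_words_append)
  next
    case 2
    \<comment> \<open>The next letter of \<open>i\<close> replaces the given second one, so that
      only letters of neighbours remain in between.\<close>
    have "\<exists>m h v. w = u @ (i, g) # m @ (i, h) # v \<and> (\<forall>p\<in>set m. {i, fst p} \<in> E)"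
    proof (cases "\<exists>p\<in>set m. fst p = i")
      case True
      then obtain a q b where "m = a @ q # b" "fst q = i" "\<forall>p\<in>set a. fst p \<noteq> i"
        using split_list_first_prop [of m "\<lambda>p. fst p = i"] by blast
      then show ?thesis
        using 2 by (intro exI [of _ a] exI [of _ "snd q"] exI [of _ "b @ (i, h) # v"]) (cases q, auto)
    next
      case False
      then show ?thesis using 2 by (intro exI [of _ m] exI [of _ h] exI [of _ v]) auto
    qed
    then obtain m h v where w: "w = u @ (i, g) # m @ (i, h) # v" and m: "\<And>p. p \<in> set m \<Longrightarrow> {i, fst p} \<in> E"
      by blast
    have W: "u \<in> fp_words V G" "m \<in> fp_words V G" "v \<in> fp_words V G" "i \<in> V"
      "g \<in> carrier (G i)" "h \<in> carrier (G i)"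
      using assms(1) by (auto simp: w fp_words_append fp_words_Cons)
    interpret Gi: group "G i" using W(4) by (rule group_G)
    have "gcls w = gcls ((u @ [(i, g)]) @ (m @ [(i, h)]) @ v)" by (simp add: w)
    also have "\<dots> = gcls ((u @ [(i, g)]) @ ((i, h) # m) @ v)"
      by (rule gcls_context [OF _ _ _ _ gcls_move [OF W(4,6,2) m]])
         (use W in \<open>simp_all add: fp_words_append fp_words_Cons fp_words_Nil\<close>)
    also have "\<dots> = gcls (u @ [(i, g), (i, h)] @ (m @ v))" by simp
    also have "\<dots> = gcls (u @ [(i, g \<otimes>\<^bsub>G i\<^esub> h)] @ (m @ v))"
      by (rule gcls_eq, rule fp_mult) (use W in \<open>simp_all add: fp_words_append\<close>)
    finally have "gcls w = gcls (u @ [(i, g \<otimes>\<^bsub>G i\<^esub> h)] @ (m @ v))" .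
    moreover have "u @ [(i, g \<otimes>\<^bsub>G i\<^esub> h)] @ (m @ v) \<in> fp_words V G"
      using W by (simp add: fp_words_append fp_words_Cons fp_words_Nil)
    ultimately show ?thesis by (intro bexI) (auto simp: w)
  qed
qed

lemma reduced_representative:
  assumes "w \<in> fp_words V G"
  shows "\<exists>w'\<in>fp_words V G. reduced_word nonadjacent G w' \<and> gcls w' = gcls w"
  using assms
proof (induction "length w" arbitrary: w rule: less_induct)
  case less
  show ?case
  proof (cases "reduced_word nonadjacent G w")
    case False
    then obtain w' where "w' \<in> fp_words V G" "length w' < length w" "gcls w' = gcls w"
      using shorten [OF less.prems] by blast
    then show ?thesis using less.hyps [of w'] by auto
  qed (use less.prems in blast)
qed

text \<open>The universal property of the graph product, stated for words: \<open>ev\<close>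
  respects \<open>fp_rel\<close>, and the induced homomorphism on \<open>F\<close> kills the
  commutators, hence their normal closure.\<close>

lemma word_hom_factors:
  assumes H: "group H" and ev: "\<And>w. w \<in> fp_words V G \<Longrightarrow> ev w \<in> carrier H"
    and ev_append: "\<And>u w. u \<in> fp_words V G \<Longrightarrow> w \<in> fp_words V G \<Longrightarrow> ev (u @ w) = ev u \<otimes>\<^bsub>H\<^esub> ev w"
    and ev_one: "\<And>i. i \<in> V \<Longrightarrow> ev [(i, \<one>\<^bsub>G i\<^esub>)] = \<one>\<^bsub>H\<^esub>"
    and ev_mult: "\<And>i g h. i \<in> V \<Longrightarrow> g \<in> carrier (G i) \<Longrightarrow> h \<in> carrier (G i) \<Longrightarrow>
      ev [(i, g \<otimes>\<^bsub>G i\<^esub> h)] = ev [(i, g)] \<otimes>\<^bsub>H\<^esub> ev [(i, h)]"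
    and ev_commute: "\<And>i j a b. i \<in> V \<Longrightarrow> j \<in> V \<Longrightarrow> {i, j} \<in> E \<Longrightarrow> a \<in> carrier (G i) \<Longrightarrow> b \<in> carrier (G j) \<Longrightarrow>
      ev [(i, a)] \<otimes>\<^bsub>H\<^esub> ev [(j, b)] = ev [(j, b)] \<otimes>\<^bsub>H\<^esub> ev [(i, a)]"
  obtains \<Phi> where "\<Phi> \<in> hom P H" "\<And>w. w \<in> fp_words V G \<Longrightarrow> \<Phi> (gcls w) = ev w"
proof -
  interpret H: group H by (rule H)
  interpret F: group F by (rule group_F)
  interpret N: normal N F by (rule normal_N)
  have letter: "[(i, g)] \<in> fp_words V G" if "i \<in> V" "g \<in> carrier (G i)" for i g
    using that by (simp add: fp_words_Cons fp_words_Nil)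
  have rel: "ev u = ev w" if "(u, w) \<in> fp_rel V G" for u w
    using that
  proof (induction rule: fp_rel.induct)
    case (fp_one u w i)
    interpret Gi: group "G i" using fp_one by (simp add: group_G)
    show ?case using fp_one letter [of i] by (simp add: ev ev_append ev_one fp_words_append del: append_Cons)
  next
    case (fp_mult u w i g h)
    interpret Gi: group "G i" using fp_mult by (simp add: group_G)
    have "ev [(i, g), (i, h)] = ev [(i, g \<otimes>\<^bsub>G i\<^esub> h)]"
      using fp_mult ev_append [OF letter letter, of i g i h] by (simp add: ev_mult)
    moreover have "[(i, g), (i, h)] \<in> fp_words V G" using fp_mult by (simp add: fp_words_Cons fp_words_Nil)
    ultimately show ?case using fp_mult letter [of i]
      by (simp add: ev_append fp_words_append del: append_Cons)
  qed auto
  define \<Psi> where "\<Psi> = (\<lambda>X. ev (SOME w. w \<in> fp_words V G \<and> fcls w = X))"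
  have \<Psi>: "\<Psi> (fcls w) = ev w" if w: "w \<in> fp_words V G" for w
  proof -
    let ?v = "SOME v. v \<in> fp_words V G \<and> fcls v = fcls w"
    have "?v \<in> fp_words V G \<and> fcls ?v = fcls w"
      by (rule someI [of _ w]) (simp add: w)
    then have "(?v, w) \<in> fp_rel V G" using fcls_eqD w by blast
    then show ?thesis unfolding \<Psi>_def by (rule rel)
  qed
  have hom_\<Psi>: "\<Psi> \<in> hom F H"
  proof (rule homI)
    fix x assume "x \<in> carrier F"
    then show "\<Psi> x \<in> carrier H" by (auto simp: carrier_F \<Psi> ev)
  next
    fix x y assume "x \<in> carrier F" "y \<in> carrier F"
    then show "\<Psi> (x \<otimes>\<^bsub>F\<^esub> y) = \<Psi> x \<otimes>\<^bsub>H\<^esub> \<Psi> y"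
      by (auto simp: carrier_F \<Psi> ev_append fp_words_append simp flip: fcls_append)
  qed
  interpret \<Psi>: group_hom F H \<Psi>
    by (intro group_hom.intro group_hom_axioms.intro group_F H hom_\<Psi>)
  have "graph_commutators V E G \<subseteq> kernel F H \<Psi>"
  proof
    fix k assume "k \<in> graph_commutators V E G"
    then obtain i j a b where ij: "i \<in> V" "j \<in> V" "{i, j} \<in> E" "a \<in> carrier (G i)" "b \<in> carrier (G j)"
      and k: "k = fcls [(i, a)] \<otimes>\<^bsub>F\<^esub> fcls [(j, b)] \<otimes>\<^bsub>F\<^esub> inv\<^bsub>F\<^esub> fcls [(i, a)] \<otimes>\<^bsub>F\<^esub> inv\<^bsub>F\<^esub> fcls [(j, b)]"
      unfolding graph_commutators_def Let_def fp_inj_def fcls_def by blast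
    have w: "[(i, a)] \<in> fp_words V G" "[(j, b)] \<in> fp_words V G" using letter ij by auto
    note c = fcls_closed [OF w(1)] fcls_closed [OF w(2)]
    have "\<Psi> k = ev [(i, a)] \<otimes>\<^bsub>H\<^esub> ev [(j, b)] \<otimes>\<^bsub>H\<^esub> inv\<^bsub>H\<^esub> ev [(i, a)] \<otimes>\<^bsub>H\<^esub> inv\<^bsub>H\<^esub> ev [(j, b)]"
      using c w by (simp add: k \<Psi>)
    also have "\<dots> = \<one>\<^bsub>H\<^esub>"
      using ev [OF w(1)] ev [OF w(2)] by (simp add: ev_commute [OF ij] H.m_assoc)
    finally show "k \<in> kernel F H \<Psi>" using c by (simp add: kernel_def k)
  qed
  then have ker: "N \<subseteq> kernel F H \<Psi>"
    using \<Psi>.normal_kernel unfolding normal_closure_def by blast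
  have key: "ev u = ev w" if "gcls u = gcls w" "u \<in> fp_words V G" "w \<in> fp_words V G" for u w
  proof -
    have "fcls u \<in> gcls u"
      unfolding gcls_def by (rule F.rcos_self [OF fcls_closed [OF that(2)] N.is_subgroup])
    then have "fcls u \<in> gcls w" by (simp only: that(1))
    then obtain n where n: "n \<in> N" "fcls u = n \<otimes>\<^bsub>F\<^esub> fcls w"
      by (auto simp: gcls_def r_coset_def)
    have "n \<in> carrier F" "\<Psi> n = \<one>\<^bsub>H\<^esub>" using n(1) ker by (auto simp: kernel_def)
    then have "\<Psi> (fcls u) = \<Psi> (fcls w)"
      using fcls_closed [OF that(3)] by (simp add: n(2))
    then show ?thesis using \<Psi> that by simp
  qed
  define \<Phi> where "\<Phi> = (\<lambda>X. ev (SOME w. w \<in> fp_words V G \<and> gcls w = X))"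
  have \<Phi>: "\<Phi> (gcls w) = ev w" if w: "w \<in> fp_words V G" for w
  proof -
    let ?v = "SOME v. v \<in> fp_words V G \<and> gcls v = gcls w"
    have "?v \<in> fp_words V G \<and> gcls ?v = gcls w"
      by (rule someI [of _ w]) (simp add: w)
    then show ?thesis unfolding \<Phi>_def using key w by blast
  qed
  have "\<Phi> \<in> hom P H"
  proof (rule homI)
    fix x assume "x \<in> carrier P"
    then show "\<Phi> x \<in> carrier H" by (auto simp: carrier_P \<Phi> ev)
  next
    fix x y assume "x \<in> carrier P" "y \<in> carrier P"
    then show "\<Phi> (x \<otimes>\<^bsub>P\<^esub> y) = \<Phi> x \<otimes>\<^bsub>H\<^esub> \<Phi> y"
      by (auto simp: carrier_P \<Phi> ev_append fp_words_append simp flip: gcls_append)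
  qed
  then show ?thesis using that \<Phi> by blast
qed

end

lemma rca_groupI:
  fixes G :: "('g, 'm) monoid_scheme" and h :: "'g \<Rightarrow> (int \<Rightarrow> 'a::finite) \<Rightarrow> int \<Rightarrow> 'a"
  assumes "group G" "h \<in> hom G Aut_full_shift" "\<And>x. x \<in> carrier G \<Longrightarrow> h x = id \<Longrightarrow> x = \<one>\<^bsub>G\<^esub>"
  shows "rca_group TYPE('a) G"
proof -
  interpret h: group_hom G Aut_full_shift h
    by (intro group_hom.intro group_hom_axioms.intro assms group_Aut_full_shift)
  have "kernel G Aut_full_shift h = {\<one>\<^bsub>G\<^esub>}"
    using assms(3) h.hom_one by (auto simp: kernel_def Aut_simps(2))
  then have "inj_on h (carrier G)" by (simp add: h.inj_iff_trivial_ker)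
  then have "h \<in> iso G (Aut_full_shift\<lparr>carrier := h ` carrier G\<rparr>)"
    using assms(2) by (auto simp: iso_def hom_def bij_betw_def)
  then show ?thesis
    unfolding rca_group_def is_iso_def using assms(1) h.img_is_subgroup by blast
qed

lemma rca_groupE:
  fixes G :: "('g, 'm) monoid_scheme" and T :: "'a::finite itself"
  assumes "rca_group T G"
  obtains h :: "'g \<Rightarrow> (int \<Rightarrow> 'a) \<Rightarrow> int \<Rightarrow> 'a" where "group G" "h \<in> hom G Aut_full_shift" "inj_on h (carrier G)"
proof -
  obtain H h where "group G" "subgroup H (Aut_full_shift :: ((int \<Rightarrow> 'a) \<Rightarrow> int \<Rightarrow> 'a) monoid)"
    and h: "h \<in> iso G (Aut_full_shift\<lparr>carrier := H\<rparr> :: ((int \<Rightarrow> 'a) \<Rightarrow> int \<Rightarrow> 'a) monoid)"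
    using assms unfolding rca_group_def is_iso_def by blast
  then have "H \<subseteq> carrier Aut_full_shift" by (simp add: subgroup.subset)
  then have "h \<in> hom G Aut_full_shift" "inj_on h (carrier G)"
    using h by (auto simp: iso_def hom_def bij_betw_def)
  then show ?thesis using that \<open>group G\<close> by blast
qed

section \<open>The embedding\<close>

lemma cell_family_exists:
  fixes V :: "'v set" and G :: "'v \<Rightarrow> ('g, 'm) monoid_scheme"
  assumes V: "countable V" and a: "(a0 :: 'a::finite) \<noteq> a1"
    and nc: "\<And>i. \<not> nc i i" "\<And>i j. nc i j \<Longrightarrow> nc j i"
    and \<phi>: "\<And>i. i \<in> V \<Longrightarrow> group (G i)" "\<And>i. i \<in> V \<Longrightarrow> \<phi> i \<in> hom (G i) Aut_full_shift"
      "\<And>i. i \<in> V \<Longrightarrow> inj_on (\<phi> i) (carrier (G i))"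
  shows "\<exists>cond C Out. cell_family a0 a1 cond V nc C Out G (\<phi> :: 'v \<Rightarrow> 'g \<Rightarrow> (int \<Rightarrow> 'a) \<Rightarrow> int \<Rightarrow> 'a)"
proof -
  define \<iota> where "\<iota> = to_nat_on V"
  have inj: "\<iota> i = \<iota> j \<longleftrightarrow> i = j" if "i \<in> V" "j \<in> V" for i j
    using inj_on_to_nat_on [OF V] that by (auto simp: \<iota>_def inj_on_def)
  define below where "below = (\<lambda>i. {j \<in> V. \<iota> j < \<iota> i \<and> nc i j})"
  have fin: "finite (below i)" for i
  proof (rule finite_imageD)
    show "finite (\<iota> ` below i)" by (rule finite_subset [of _ "{..<\<iota> i}"]) (auto simp: below_def)
    show "inj_on \<iota> (below i)" using inj by (auto simp: below_def inj_on_def)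
  qed
  \<comment> \<open>For nonadjacent \<open>i\<close> and \<open>j\<close> the only common element of \<open>In i\<close> and \<open>Out j\<close> is built from the smaller of
    the two indices. This keeps both sets finite, so the automaton of each vertex stays local
    although \<open>V\<close> may be infinite.\<close>
  define Out where "Out = (\<lambda>i. insert (2 * \<iota> i) ((\<lambda>j. 2 * \<iota> j + 1) ` below i))"
  define In where "In = (\<lambda>i. insert (2 * \<iota> i + 1) ((\<lambda>j. 2 * \<iota> j) ` below i))"
  define cond where "cond = (\<lambda>n. snd (from_nat n :: nat \<times> (nat \<times> 'a) option))"
  \<comment> \<open>A code encodes a vertex number together with an optional condition. The number
    makes the sets disjoint, and finiteness of \<open>In i\<close> and of the alphabet makes them
    finite.\<close>
  define C where "C = (\<lambda>i. to_nat ` ({\<iota> i} \<times> insert None (Some ` (In i \<times> (UNIV :: 'a set)))))"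
  interpret cell_code a0 a1 cond by unfold_locales (rule a)
  have reads: "reads (C i) = In i" for i
    unfolding reads_def C_def by (auto simp: cond_def)
  have code: "\<exists>n\<in>C i. cond n = Some (t, a)" if "t \<in> In i" for i t a
    using that by (intro bexI [of _ "to_nat (\<iota> i, Some (t, a))"]) (auto simp: C_def cond_def)
  have "cell_family a0 a1 cond V nc C Out G \<phi>"
  proof (intro cell_family.intro cell_family_axioms.intro cell_code_axioms)
    show "finite (C i)" "finite (Out i)" for i
      using fin by (auto simp: C_def Out_def In_def)
    show "C i \<inter> C j = {}" if "i \<in> V" "j \<in> V" "i \<noteq> j" for i j
      using that inj by (auto simp: C_def)
    show "reads (C i) \<inter> Out j = {}" if "i \<in> V" "j \<in> V" "\<not> nc i j" for i j
    proof (rule ccontr)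
      assume "reads (C i) \<inter> Out j \<noteq> {}"
      then obtain t where "t \<in> In i" "t \<in> Out j" by (auto simp: reads)
      \<comment> \<open>By parity a tag common to both sets comes from \<open>below\<close> on
        exactly one side; the vertex found there is the other one of \<open>i\<close> and
        \<open>j\<close>, which contradicts \<open>\<not> nc i j\<close>.\<close>
      then have "(\<exists>k\<in>below i. \<iota> k = \<iota> j) \<or> (\<exists>k\<in>below j. \<iota> k = \<iota> i)"
        unfolding In_def Out_def by auto presburger+
      then show False using that inj nc(2) by (auto simp: below_def)
    qed
    show "\<exists>t\<in>Out j. \<forall>a. \<exists>n\<in>C i. cond n = Some (t, a)" if "i \<in> V" "j \<in> V" "nc i j" for i j
    proof -
      have "i \<noteq> j" using nc(1) that(3) by blast
      then consider "\<iota> i < \<iota> j" | "\<iota> j < \<iota> i" using inj [OF \<open>i \<in> V\<close> \<open>j \<in> V\<close>] by linarith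
      then have "In i \<inter> Out j \<noteq> {}"
      proof cases
        case 1
        then have "i \<in> below j" using that nc(2) by (simp add: below_def)
        then show ?thesis by (auto simp: In_def Out_def)
      next
        case 2
        then have "j \<in> below i" using that by (simp add: below_def)
        then show ?thesis by (auto simp: In_def Out_def)
      qed
      then show ?thesis using code by blast
    qed
    show "\<exists>t. \<forall>a. \<exists>n\<in>C i. cond n = Some (t, a)" for i
      using code [of "2 * \<iota> i + 1" i] by (auto simp: In_def)
    show "\<exists>n\<in>C i. cond n = None" for i
      by (rule bexI [of _ "to_nat (\<iota> i, None :: (nat \<times> 'a) option)"]) (auto simp: C_def cond_def)
    show "Out i \<noteq> {}" for i by (simp add: Out_def)
  qed (fact nc \<phi>)+
  then show ?thesis by blast
qed

theorem theorem1:
  fixes V :: "'v set" and E :: "'v set set"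
    and G :: "'v \<Rightarrow> ('g, 'm) monoid_scheme"
  assumes "CARD('a::finite) \<ge> 2"
    and "countable V"
    and "E \<subseteq> {{u, v} | u v. u \<in> V \<and> v \<in> V \<and> u \<noteq> v}"
    and "\<And>i. i \<in> V \<Longrightarrow> rca_group TYPE('a) (G i)"
  shows "rca_group TYPE('a) (graph_product V E G)"
proof -
  have "\<not> CARD('a) \<le> Suc 0" using assms(1) by simp
  then obtain a0 a1 :: 'a where a: "a0 \<noteq> a1"
    using card_le_Suc0_iff_eq [of "UNIV :: 'a set"] by auto
  have "\<forall>i\<in>V. \<exists>h :: 'g \<Rightarrow> (int \<Rightarrow> 'a) \<Rightarrow> int \<Rightarrow> 'a.
      group (G i) \<and> h \<in> hom (G i) Aut_full_shift \<and> inj_on h (carrier (G i))"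
    using assms(4) by (meson rca_groupE)
  then obtain \<phi> :: "'v \<Rightarrow> 'g \<Rightarrow> (int \<Rightarrow> 'a) \<Rightarrow> int \<Rightarrow> 'a" where \<phi>: "\<And>i. i \<in> V \<Longrightarrow> group (G i)"
    "\<And>i. i \<in> V \<Longrightarrow> \<phi> i \<in> hom (G i) Aut_full_shift" "\<And>i. i \<in> V \<Longrightarrow> inj_on (\<phi> i) (carrier (G i))"
    by (metis (no_types))
  define nc where "nc = (\<lambda>i j. i \<noteq> j \<and> {i, j} \<notin> E)"
  have nc: "\<And>i. \<not> nc i i" "\<And>i j. nc i j \<Longrightarrow> nc j i"
    by (auto simp: nc_def insert_commute)
  obtain cond C Out where "cell_family a0 a1 cond V nc C Out G \<phi>"
    using cell_family_exists [of V a0 a1 nc G \<phi>, OF assms(2) a nc \<phi>] by blast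
  then interpret A: cell_family a0 a1 cond V nc C Out G \<phi> .
  interpret P: group_family V E G by (rule group_family.intro) (rule \<phi>(1))
  interpret Aut: group "Aut_full_shift :: ((int \<Rightarrow> 'a) \<Rightarrow> int \<Rightarrow> 'a) monoid"
    by (rule group_Aut_full_shift)
  have ne: "i \<noteq> j" if "{i, j} \<in> E" for i j
    using assms(3) that by (auto simp: doubleton_eq_iff)
  obtain \<Phi> where \<Phi>: "\<Phi> \<in> hom (graph_product V E G) Aut_full_shift"
    "\<And>w. w \<in> fp_words V G \<Longrightarrow> \<Phi> (P.gcls w) = A.ev w"
  proof (rule P.word_hom_factors [of Aut_full_shift A.ev])
    show "A.ev w \<in> carrier Aut_full_shift" if "w \<in> fp_words V G" for w
      using that
    proof (induction w)
      case Nil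
      show ?case using Aut.one_closed by (simp only: Aut_simps A.ev.simps)
    next
      case (Cons p w)
      have "A.rho (fst p) (snd p) \<in> carrier Aut_full_shift" "A.ev w \<in> carrier Aut_full_shift"
        using Cons A.rho_Aut by (cases p; simp add: fp_words_Cons)+
      then show ?case using Aut.m_closed by (simp only: Aut_simps A.ev.simps)
    qed
    show "A.ev [(i, a)] \<otimes>\<^bsub>Aut_full_shift\<^esub> A.ev [(j, b)] = A.ev [(j, b)] \<otimes>\<^bsub>Aut_full_shift\<^esub> A.ev [(i, a)]"
      if "i \<in> V" "j \<in> V" "{i, j} \<in> E" for i j a b
      using A.rho_commute [OF that(1,2) ne [OF that(3)]] that(3) by (simp add: Aut_simps nc_def)
  qed (auto simp: group_Aut_full_shift Aut_simps A.ev_append A.rho_one A.rho_mult)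
  show ?thesis
  proof (rule rca_groupI [OF group_graph_product [OF \<phi>(1)] \<Phi>(1)])
    fix x assume "x \<in> carrier (graph_product V E G)" and x: "\<Phi> x = id"
    then obtain w where w: "w \<in> fp_words V G" "x = P.gcls w" by (auto simp: P.carrier_P)
    obtain v where v: "v \<in> fp_words V G" "reduced_word (\<lambda>i j. i \<noteq> j \<and> {i, j} \<notin> E) G v" "P.gcls v = x"
      using P.reduced_representative [OF w(1)] w(2) by blast
    have "A.ev v = id" using \<Phi>(2) [OF v(1)] v(3) x by simp
    then have "v = []" using A.reduced_nontrivial [OF v(1)] v(2) unfolding nc_def by blast
    then have "x = P.gcls []" using v(3) by simp
    moreover have "P.gcls [] = \<one>\<^bsub>graph_product V E G\<^esub>"
    proof -
      interpret Q: group "graph_product V E G" by (rule group_graph_product [OF \<phi>(1)])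
      have "P.gcls [] \<in> carrier (graph_product V E G)"
        by (auto simp: P.carrier_P fp_words_Nil)
      moreover have "P.gcls [] \<otimes>\<^bsub>graph_product V E G\<^esub> P.gcls [] = P.gcls []"
        using P.gcls_append [OF fp_words_Nil fp_words_Nil] by simp
      ultimately show ?thesis by (simp add: Q.l_cancel_one)
    qed
    ultimately show "x = \<one>\<^bsub>graph_product V E G\<^esub>" by simp
  qed
qed

end
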